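(* Let $p \ge 5$ be real, let $n \ge 1$ be an integer, and let $S_n = \varepsilon_1 + \ldots + \varepsilon_n$. Then $$C_{p,4,n+1} = \sup_{x \ge 1} \frac{\|x + S_n\|_p}{\|x+S_n\|_4}.$$
   Context: Let $\varepsilon_1,\varepsilon_2,\ldots$ be i.i.d. symmetric Bernoulli (Rademacher) random variables, i.e. $\mathbb{P}(\varepsilon_i = \pm 1) = \frac12$. For a real random variable $X$ and $p>0$ write $\|X\|_p = (\mathbb{E}|X|^p)^{1/p}$. For $a=(a_1,\ldots,a_m)\in\mathbb{R}^m$ put $S_a = \sum_{i=1}^m a_i\varepsilon_i$. The dimension dependent optimal Khintchine constant is $$C_{p,q,m} = \max_{a \in S^{m-1}} \frac{\|S_a\|_p}{\|S_a\|_q},$$ where $S^{m-1}$ is the Euclidean unit sphere in $\mathbb{R}^m$ (equivalently, the smallest constant $C$ with $\|S_a\|_p \le C\|S_a\|_q$ for all $a\in\mathbb{R}^m$). In the claim, $x$ ranges over real numbers. *)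

theory Defs
  imports "HOL-Probability.Probability"
begin

definition Lp_norm :: "'a measure \<Rightarrow> real \<Rightarrow> ('a \<Rightarrow> real) \<Rightarrow> real" where
  "Lp_norm M p X = (\<integral>\<omega>. \<bar>X \<omega>\<bar> powr p \<partial>M) powr (1 / p)"

text \<open>The sequence is indexed from 1; \<open>\<epsilon> 0\<close> is irrelevant and unconstrained.\<close>

locale rademacher_sequence = prob_space M for M :: "'a measure" +
  fixes \<epsilon> :: "nat \<Rightarrow> 'a \<Rightarrow> real"
  assumes indep: "indep_vars (\<lambda>_. borel) \<epsilon> {1..}"
    and prob_pos: "i \<ge> 1 \<Longrightarrow> prob {\<omega> \<in> space M. \<epsilon> i \<omega> = 1} = 1 / 2"
    and prob_neg: "i \<ge> 1 \<Longrightarrow> prob {\<omega> \<in> space M. \<epsilon> i \<omega> = -1} = 1 / 2"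

definition rademacher_sum ::
  "(nat \<Rightarrow> 'a \<Rightarrow> real) \<Rightarrow> nat \<Rightarrow> (nat \<Rightarrow> real) \<Rightarrow> 'a \<Rightarrow> real" where
  "rademacher_sum \<epsilon> m a \<omega> = (\<Sum>i=1..m. a i * \<epsilon> i \<omega>)"

text \<open>Vectors \<open>(a\<^sub>1, \<dots>, a\<^sub>m)\<close> are functions vanishing outside \<open>{1..m}\<close>.\<close>

definition unit_sphere :: "nat \<Rightarrow> (nat \<Rightarrow> real) set" where
  "unit_sphere m = {a. (\<forall>i. i \<notin> {1..m} \<longrightarrow> a i = 0) \<and> (\<Sum>i=1..m. (a i)\<^sup>2) = 1}"

text \<open>For \<open>m \<ge> 1\<close> and \<open>p, q > 0\<close> this supremum is a maximum: see
  \<open>khintchine_const_is_max\<close> below.\<close>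

definition khintchine_const ::
  "'a measure \<Rightarrow> (nat \<Rightarrow> 'a \<Rightarrow> real) \<Rightarrow> real \<Rightarrow> real \<Rightarrow> nat \<Rightarrow> real" where
  "khintchine_const M \<epsilon> p q m =
     (SUP a\<in>unit_sphere m. Lp_norm M p (rademacher_sum \<epsilon> m a) / Lp_norm M q (rademacher_sum \<epsilon> m a))"


lemma rademacher_sequence_exists:
  "\<exists>(M :: (nat \<Rightarrow> real) measure) \<epsilon>. rademacher_sequence M \<epsilon>"
proof -
  define D :: "real measure" where "D = distr (measure_pmf (pmf_of_set {1, -1})) borel (\<lambda>x. x)"
  define M :: "(nat \<Rightarrow> real) measure" where "M = PiM UNIV (\<lambda>_. D)"
  define e :: "nat \<Rightarrow> (nat \<Rightarrow> real) \<Rightarrow> real" where "e = (\<lambda>i \<omega>. \<omega> i)"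
  have D: "prob_space D"
    unfolding D_def by (rule prob_space.prob_space_distr) (auto intro: prob_space_measure_pmf)
  have sets_D [measurable_cong]: "sets D = sets borel" by (simp add: D_def)
  interpret M: prob_space M
    unfolding M_def by (rule prob_space_PiM) (rule D)
  have e [measurable]: "e i \<in> borel_measurable M" for i
    unfolding e_def M_def by measurable
  have distr: "distr M borel (e i) = D" for i
  proof -
    have "distr M borel (e i) = distr (PiM UNIV (\<lambda>_. D)) D (\<lambda>\<omega>. \<omega> i)"
      unfolding M_def e_def by (rule distr_cong) (auto simp: sets_D)
    also have "\<dots> = D" by (rule distr_PiM_component) (auto intro: D)
    finally show ?thesis .
  qed
  have "M.indep_vars (\<lambda>_. borel) e UNIV"
  proof (subst M.indep_vars_iff_distr_eq_PiM')
    have "distr M (PiM UNIV (\<lambda>_. borel)) (\<lambda>x. \<lambda>i\<in>UNIV. e i x) = distr M M (\<lambda>x. x)"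
      by (rule distr_cong)
        (auto simp: e_def M_def restrict_def intro!: sets_PiM_cong sets_D[symmetric])
    also have "\<dots> = PiM UNIV (\<lambda>i. distr M borel (e i))"
      by (simp add: distr M_def[symmetric])
    finally show "distr M (PiM UNIV (\<lambda>_. borel)) (\<lambda>x. \<lambda>i\<in>UNIV. e i x) =
      PiM UNIV (\<lambda>i. distr M borel (e i))" .
  qed auto
  then have "M.indep_vars (\<lambda>_. borel) e {1..}"
    by (rule M.indep_vars_subset) auto
  moreover have "M.prob {\<omega> \<in> space M. e i \<omega> = c} = 1 / 2" if "c = 1 \<or> c = -1" for i c
  proof -
    have "M.prob {\<omega> \<in> space M. e i \<omega> = c} = measure (distr M borel (e i)) {c}"
      by (subst measure_distr) (auto simp: vimage_def Int_def intro!: arg_cong[where f = M.prob])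
    also have "\<dots> = measure (measure_pmf (pmf_of_set {1, -1})) {c}"
      unfolding distr D_def by (subst measure_distr) auto
    also have "\<dots> = 1 / 2" using that by (auto simp: measure_pmf_single)
    finally show ?thesis .
  qed
  ultimately have "rademacher_sequence M e"
    by unfold_locales auto
  then show ?thesis by blast
qed

context rademacher_sequence
begin

lemma eps_measurable: "i \<ge> 1 \<Longrightarrow> \<epsilon> i \<in> borel_measurable M"
  using indep by (auto simp: indep_vars_def2)

lemma AE_abs_eps:
  assumes "i \<ge> 1"
  shows "AE \<omega> in M. \<bar>\<epsilon> i \<omega>\<bar> = 1"
proof -
  note [measurable] = eps_measurable[OF assms]
  have "prob {\<omega> \<in> space M. \<bar>\<epsilon> i \<omega>\<bar> = 1} =
      prob ({\<omega> \<in> space M. \<epsilon> i \<omega> = 1} \<union> {\<omega> \<in> space M. \<epsilon> i \<omega> = -1})"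
    by (intro arg_cong[where f = prob]) auto
  also have "\<dots> = prob {\<omega> \<in> space M. \<epsilon> i \<omega> = 1} + prob {\<omega> \<in> space M. \<epsilon> i \<omega> = -1}"
    by (rule finite_measure_Union) auto
  also have "\<dots> = 1" using assms by (simp add: prob_pos prob_neg)
  finally have "prob {\<omega> \<in> space M. \<bar>\<epsilon> i \<omega>\<bar> = 1} = 1" .
  from AE_prob_1[OF this] show ?thesis by auto
qed

lemma AE_all_abs_eps: "AE \<omega> in M. \<forall>i\<in>{1..m}. \<bar>\<epsilon> i \<omega>\<bar> = 1"
  by (intro AE_finite_allI) (auto intro: AE_abs_eps)

lemma rademacher_sum_measurable: "rademacher_sum \<epsilon> m a \<in> borel_measurable M"
  unfolding rademacher_sum_def using eps_measurable by (intro borel_measurable_sum) auto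

lemma prob_signs:
  assumes "\<And>i. s i = 1 \<or> s i = (-1::real)"
  shows "prob {\<omega> \<in> space M. \<forall>i\<in>{1..m}. \<epsilon> i \<omega> = s i} = (1 / 2) ^ m"
proof (cases "m = 0")
  case True
  then show ?thesis by (simp add: prob_space)
next
  case False
  have "prob {\<omega> \<in> space M. \<forall>i\<in>{1..m}. \<epsilon> i \<omega> = s i} =
      prob (\<Inter>i\<in>{1..m}. \<epsilon> i -` {s i} \<inter> space M)"
    using False by (intro arg_cong[where f = prob]) auto
  also have "\<dots> = (\<Prod>i\<in>{1..m}. prob (\<epsilon> i -` {s i} \<inter> space M))"
    using False by (intro indep_varsD[OF indep]) auto
  also have "\<dots> = (\<Prod>i\<in>{1..m}. 1 / 2)"
  proof (rule prod.cong)
    fix i assume "i \<in> {1..m}"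
    then have "prob {\<omega> \<in> space M. \<epsilon> i \<omega> = s i} = 1 / 2"
      using assms[of i] by (auto simp: prob_pos prob_neg)
    moreover have "\<epsilon> i -` {s i} \<inter> space M = {\<omega> \<in> space M. \<epsilon> i \<omega> = s i}" by auto
    ultimately show "prob (\<epsilon> i -` {s i} \<inter> space M) = 1 / 2" by simp
  qed simp
  finally show ?thesis by simp
qed

lemma integrable_powr:
  fixes X :: "'a \<Rightarrow> real" and B p :: real
  assumes [measurable]: "X \<in> borel_measurable M"
    and B: "AE \<omega> in M. \<bar>X \<omega>\<bar> \<le> B" and "p > 0"
  shows "integrable M (\<lambda>\<omega>. \<bar>X \<omega>\<bar> powr p)"
proof (rule integrable_const_bound)
  show "AE \<omega> in M. norm (\<bar>X \<omega>\<bar> powr p) \<le> B powr p"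
    using B by eventually_elim (use \<open>p > 0\<close> in \<open>auto intro: powr_mono2\<close>)
qed measurable

lemma Lp_norm_le:
  assumes X [measurable]: "X \<in> borel_measurable M"
    and B: "AE \<omega> in M. \<bar>X \<omega>\<bar> \<le> B" and p: "p > 0" and "B \<ge> 0"
  shows "Lp_norm M p X \<le> B"
proof -
  have "(\<integral>\<omega>. \<bar>X \<omega>\<bar> powr p \<partial>M) \<le> (\<integral>\<omega>. B powr p \<partial>M)"
    by (intro integral_mono_AE integrable_powr[OF X B p] integrable_const)
      (use B p in \<open>auto elim!: eventually_mono intro: powr_mono2\<close>)
  also have "\<dots> = B powr p" by (simp add: prob_space)
  finally have "Lp_norm M p X \<le> (B powr p) powr (1 / p)"
    unfolding Lp_norm_def using p by (intro powr_mono2) auto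
  then show ?thesis using p \<open>B \<ge> 0\<close> by (simp add: powr_powr)
qed

lemma Lp_norm_ge:
  assumes X [measurable]: "X \<in> borel_measurable M"
    and B: "AE \<omega> in M. \<bar>X \<omega>\<bar> \<le> B" and p: "p > 0"
    and A [measurable]: "A \<in> sets M" and c: "c \<ge> 0" "\<And>\<omega>. \<omega> \<in> A \<Longrightarrow> c \<le> \<bar>X \<omega>\<bar>"
  shows "prob A powr (1 / p) * c \<le> Lp_norm M p X"
proof -
  have "prob A * c powr p = (\<integral>\<omega>. indicator A \<omega> * c powr p \<partial>M)"
    by simp
  also have "\<dots> \<le> (\<integral>\<omega>. \<bar>X \<omega>\<bar> powr p \<partial>M)"
  proof (intro integral_mono integrable_powr[OF X B p] integrable_mult_left)
    show "integrable M (indicator A :: 'a \<Rightarrow> real)"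
      by (rule integrable_real_indicator) (auto simp: less_top[symmetric])
  qed (use c p in \<open>auto simp: indicator_def intro!: powr_mono2\<close>)
  finally have "(prob A * c powr p) powr (1 / p) \<le> Lp_norm M p X"
    unfolding Lp_norm_def using p by (intro powr_mono2) auto
  then show ?thesis using p c by (simp add: powr_mult powr_powr)
qed

lemma unit_sphere_bound:
  assumes "a \<in> unit_sphere m"
  shows "\<bar>a i\<bar> \<le> 1"
proof (cases "i \<in> {1..m}")
  case True
  then have "(a i)\<^sup>2 \<le> (\<Sum>i=1..m. (a i)\<^sup>2)" by (intro member_le_sum) auto
  then show ?thesis using assms by (simp add: unit_sphere_def abs_square_le_1)
qed (use assms in \<open>auto simp: unit_sphere_def\<close>)

lemma AE_rademacher_sum_le:
  assumes "a \<in> unit_sphere m"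
  shows "AE \<omega> in M. \<bar>rademacher_sum \<epsilon> m a \<omega>\<bar> \<le> real m"
  using AE_all_abs_eps[of m]
proof eventually_elim
  case (elim \<omega>)
  have "\<bar>rademacher_sum \<epsilon> m a \<omega>\<bar> \<le> (\<Sum>i=1..m. \<bar>a i * \<epsilon> i \<omega>\<bar>)"
    unfolding rademacher_sum_def by (rule sum_abs)
  also have "\<dots> \<le> (\<Sum>i=1..m. 1)"
    using elim unit_sphere_bound[OF assms] by (intro sum_mono) (auto simp: abs_mult)
  finally show ?case by simp
qed

lemma Lp_norm_rademacher_sum_pos:
  assumes a: "a \<in> unit_sphere m" and q: "q > 0"
  shows "Lp_norm M q (rademacher_sum \<epsilon> m a) > 0"
proof -
  define s where "s i = (if a i \<ge> 0 then 1 else -1 :: real)" for i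
  define A where "A = {\<omega> \<in> space M. \<forall>i\<in>{1..m}. \<epsilon> i \<omega> = s i}"
  define c where "c = (\<Sum>i=1..m. \<bar>a i\<bar>)"
  have prob: "prob A = (1 / 2) ^ m" unfolding A_def by (rule prob_signs) (auto simp: s_def)
  then have "prob A \<noteq> 0" by simp
  then have A: "A \<in> sets M" using measure_notin_sets by blast
  have "c \<noteq> 0"
  proof
    assume "c = 0"
    then have "\<forall>i\<in>{1..m}. a i = 0" unfolding c_def by (simp add: sum_nonneg_eq_0_iff)
    then show False using a by (simp add: unit_sphere_def)
  qed
  then have "c > 0" unfolding c_def by (simp add: less_le sum_nonneg)
  have "c \<le> \<bar>rademacher_sum \<epsilon> m a \<omega>\<bar>" if "\<omega> \<in> A" for \<omega>
  proof -
    have "rademacher_sum \<epsilon> m a \<omega> = c"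
      unfolding rademacher_sum_def c_def using that
      by (intro sum.cong) (auto simp: A_def s_def)
    then show ?thesis by simp
  qed
  from Lp_norm_ge[OF rademacher_sum_measurable AE_rademacher_sum_le[OF a] q A _ this]
  have "prob A powr (1 / q) * c \<le> Lp_norm M q (rademacher_sum \<epsilon> m a)"
    using \<open>c > 0\<close> by simp
  moreover have "prob A powr (1 / q) * c > 0" using prob \<open>c > 0\<close> by simp
  ultimately show ?thesis by linarith
qed

lemma continuous_on_coordinate: "continuous_on S (\<lambda>a :: nat \<Rightarrow> real. a i)"
  using continuous_on_product_coordinates by (rule continuous_on_subset) auto

lemma compact_unit_sphere: "compact (unit_sphere m)"
proof -
  define K where "K = PiE UNIV (\<lambda>i::nat. {-1..1::real})"
  have "compactin (product_topology (\<lambda>i. euclidean) UNIV) K"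
    unfolding K_def by (subst compactin_PiE) auto
  then have K: "compact K" by (simp add: euclidean_product_topology)
  have "closed ({a. \<forall>i. i \<notin> {1..m} \<longrightarrow> a i = 0} \<inter> {a. (\<Sum>i=1..m. (a i)\<^sup>2) = (1::real)})"
    by (intro closed_Int closed_Collect_all closed_Collect_imp closed_Collect_eq
        open_Collect_const continuous_intros continuous_on_coordinate)
  then have "closed (unit_sphere m)" by (simp add: unit_sphere_def Collect_conj_eq)
  moreover have "unit_sphere m \<subseteq> K"
    unfolding K_def using unit_sphere_bound by (fastforce simp: abs_le_iff)
  ultimately show ?thesis using K by (metis compact_Int_closed inf.absorb_iff2)
qed

lemma continuous_on_Lp_norm:
  assumes p: "p > 0"
  shows "continuous_on (unit_sphere m) (\<lambda>a. Lp_norm M p (rademacher_sum \<epsilon> m a))"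
  unfolding continuous_on_sequentially
proof (intro allI ballI impI; elim conjE)
  fix u and a assume a: "a \<in> unit_sphere m" and u: "\<forall>n. u n \<in> unit_sphere m"
    and lim: "u \<longlonglongrightarrow> a"
  have coord: "(\<lambda>n. u n i) \<longlonglongrightarrow> a i" for i
    by (rule continuous_on_tendsto_compose[OF continuous_on_coordinate[of UNIV] lim]) auto
  note [measurable] = rademacher_sum_measurable
  have "(\<lambda>n. \<integral>\<omega>. \<bar>rademacher_sum \<epsilon> m (u n) \<omega>\<bar> powr p \<partial>M)
      \<longlonglongrightarrow> (\<integral>\<omega>. \<bar>rademacher_sum \<epsilon> m a \<omega>\<bar> powr p \<partial>M)"
  proof (rule integral_dominated_convergence[where w = "\<lambda>_. real m powr p"])
    show "AE \<omega> in M. (\<lambda>n. \<bar>rademacher_sum \<epsilon> m (u n) \<omega>\<bar> powr p)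
        \<longlonglongrightarrow> \<bar>rademacher_sum \<epsilon> m a \<omega>\<bar> powr p"
      unfolding rademacher_sum_def using p
      by (intro AE_I2 tendsto_powr' tendsto_intros coord) auto
    show "AE \<omega> in M. norm (\<bar>rademacher_sum \<epsilon> m (u n) \<omega>\<bar> powr p) \<le> real m powr p" for n
      using AE_rademacher_sum_le[OF u[rule_format, of n]]
      by eventually_elim (use p in \<open>auto intro: powr_mono2\<close>)
  qed auto
  then show "((\<lambda>a. Lp_norm M p (rademacher_sum \<epsilon> m a)) \<circ> u)
      \<longlonglongrightarrow> Lp_norm M p (rademacher_sum \<epsilon> m a)"
    unfolding o_def Lp_norm_def using p by (intro tendsto_powr') auto
qed

theorem khintchine_const_is_max:
  assumes "m \<ge> 1" "p > 0" "q > 0"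
  shows "\<exists>a\<in>unit_sphere m.
      khintchine_const M \<epsilon> p q m
        = Lp_norm M p (rademacher_sum \<epsilon> m a) / Lp_norm M q (rademacher_sum \<epsilon> m a) \<and>
      (\<forall>b\<in>unit_sphere m. Lp_norm M p (rademacher_sum \<epsilon> m b) / Lp_norm M q (rademacher_sum \<epsilon> m b)
        \<le> khintchine_const M \<epsilon> p q m)"
proof -
  let ?f = "\<lambda>a. Lp_norm M p (rademacher_sum \<epsilon> m a) / Lp_norm M q (rademacher_sum \<epsilon> m a)"
  have "(\<lambda>i. if i = 1 then 1 else 0) \<in> unit_sphere m"
    using \<open>m \<ge> 1\<close> by (auto simp: unit_sphere_def if_distrib[of "\<lambda>x. x\<^sup>2"] cong: if_cong)
  then have ne: "unit_sphere m \<noteq> {}" by blast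
  have "continuous_on (unit_sphere m) ?f"
    using assms Lp_norm_rademacher_sum_pos
    by (intro continuous_on_divide continuous_on_Lp_norm) (auto simp: less_le)
  from continuous_attains_sup[OF compact_unit_sphere ne this]
  obtain a where a: "a \<in> unit_sphere m" "\<And>b. b \<in> unit_sphere m \<Longrightarrow> ?f b \<le> ?f a" by blast
  have "khintchine_const M \<epsilon> p q m = ?f a"
    unfolding khintchine_const_def using a by (intro cSup_eq_maximum) auto
  then show ?thesis using a by auto
qed

text \<open>The supremum over the shifts \<open>x \<ge> 1\<close> is one of a bounded set, hence a genuine one.\<close>

theorem bdd_above_shift_ratio:
  assumes p: "p > 0" and q: "q > 0"
  shows "bdd_above ((\<lambda>x. Lp_norm M p (\<lambda>\<omega>. x + (\<Sum>i=1..n. \<epsilon> i \<omega>)) /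
    Lp_norm M q (\<lambda>\<omega>. x + (\<Sum>i=1..n. \<epsilon> i \<omega>))) ` {1..})"
proof (rule bdd_aboveI2)
  fix x :: real assume "x \<in> {1..}"
  then have x: "x \<ge> 1" by simp
  let ?X = "\<lambda>\<omega>. x + (\<Sum>i=1..n. \<epsilon> i \<omega>)"
  define A where "A = {\<omega> \<in> space M. \<forall>i\<in>{1..n}. \<epsilon> i \<omega> = 1}"
  have prob: "prob A = (1 / 2) ^ n" unfolding A_def by (rule prob_signs) auto
  then have "prob A \<noteq> 0" by simp
  then have A: "A \<in> sets M" using measure_notin_sets by blast
  have meas: "?X \<in> borel_measurable M"
    using eps_measurable by (intro borel_measurable_add borel_measurable_sum) auto
  have "AE \<omega> in M. \<bar>?X \<omega>\<bar> \<le> x + real n"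
    using AE_all_abs_eps[of n]
  proof eventually_elim
    case (elim \<omega>)
    have "\<bar>\<Sum>i=1..n. \<epsilon> i \<omega>\<bar> \<le> (\<Sum>i=1..n. \<bar>\<epsilon> i \<omega>\<bar>)" by (rule sum_abs)
    also have "\<dots> = real n" using elim by simp
    finally show ?case using x by linarith
  qed
  moreover have "x + real n \<le> (1 + real n) * x"
    using x mult_left_mono[of 1 x "real n"] by (simp add: algebra_simps)
  ultimately have bd: "AE \<omega> in M. \<bar>?X \<omega>\<bar> \<le> (1 + real n) * x"
    by (auto elim!: eventually_mono)
  have num: "Lp_norm M p ?X \<le> (1 + real n) * x"
    by (rule Lp_norm_le[OF meas bd p]) (use x in auto)
  have den: "prob A powr (1 / q) * x \<le> Lp_norm M q ?X"
    by (rule Lp_norm_ge[OF meas bd q A]) (use x in \<open>auto simp: A_def\<close>)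
  have "Lp_norm M p ?X / Lp_norm M q ?X \<le> ((1 + real n) * x) / (prob A powr (1 / q) * x)"
    by (rule frac_le[OF _ num _ den]) (use x prob in auto)
  also have "\<dots> = (1 + real n) / ((1 / 2) ^ n) powr (1 / q)"
    using x prob by simp
  finally show "Lp_norm M p ?X / Lp_norm M q ?X \<le> (1 + real n) / ((1 / 2) ^ n) powr (1 / q)" .
qed

end

end

theory Submission
  imports Defs
begin

text \<open>
  The fourth moment of a Rademacher sum is
  \<open>3 (\<Sum> a\<^sub>i\<^sup>2)\<^sup>2 - 2 (\<Sum> a\<^sub>i ^ 4)\<close>. It depends only on the first two power sums of the squares
  \<open>u\<^sub>i = a\<^sub>i\<^sup>2\<close>, and a maximizer of the ratio also maximizes the \<open>p\<close>-th moment for given values of these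
  two sums. The key point (\<open>exchange_three\<close>, \<open>sign_ratio_exchange\<close>) is that the \<open>p\<close>-th moment does not
  decrease when three of the squares \<open>u\<^sub>1 \<ge> u\<^sub>2 \<ge> u\<^sub>3\<close> are moved, with both sums fixed, until the two
  smaller ones coincide. Along the way their product increases.

  To see this, condition on all other signs: \<open>\<bar>s\<bar> powr p\<close> is replaced by an average \<open>f\<close> of its shifts, an
  even function whose fourth derivative is convex because \<open>p \<ge> 5\<close>. The three coefficients enter through
  the numbers \<open>v\<close> of the form \<open>(\<plusminus> a \<plusminus> b \<plusminus> c)\<^sup>2\<close>. There are four of them, and they are the roots of
  \<open>(v\<^sup>2 - 2 e\<^sub>1 v + e\<^sub>1\<^sup>2 - 4 e\<^sub>2)\<^sup>2 - 64 e\<^sub>3 v\<close>, where \<open>e\<^sub>1\<close>, \<open>e\<^sub>2\<close>, \<open>e\<^sub>3\<close> are the elementary symmetric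
  functions of \<open>a\<^sup>2\<close>, \<open>b\<^sup>2\<close>, \<open>c\<^sup>2\<close>. Fixing \<open>e\<^sub>1\<close> and \<open>e\<^sub>2\<close> and differentiating the sum of the
  \<open>f (sqrt v)\<close> with respect to \<open>e\<^sub>3\<close> gives a positive multiple of the third divided difference of
  \<open>H v = sqrt v * f' (sqrt v)\<close> at the four roots (\<open>exchange_derivative_nonneg\<close>). This is nonnegative
  since \<open>H\<close> has a nonnegative third derivative (\<open>fourth_derivative_inequality\<close>).

  Exchanges need not terminate, so compactness is used instead: a maximizer with
  the largest sum of sixth powers allows no further exchange and thus, up to signs, consists of one entry
  and copies of an entry that is not larger (\<open>concentrated_maximizer\<close>). If the repeated entry is
  nonzero, rescaling it to \<open>1\<close> gives a shift \<open>x \<ge> 1\<close>. If it is \<open>0\<close>, the ratio is \<open>1\<close>, which by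
  Jensen's inequality no shift undercuts (\<open>one_le_sign_ratio\<close>). Conversely every shifted sum is, by
  symmetry and homogeneity, a multiple of a Rademacher sum with coefficients on the sphere.
\<close>

section \<open>Even functions with convex fourth derivative\<close>

text \<open>For \<open>f s = \<bar>s\<bar> powr p\<close> the fourth derivative is a positive multiple of \<open>\<bar>s\<bar> powr (p - 4)\<close>, which is
  convex for \<open>p \<ge> 5\<close>. For \<open>p = 5\<close> it has a kink at \<open>0\<close>, so that the condition cannot be
  put as a sign of further derivatives. Convexity, unlike monotonicity on the
  half-line, survives shifts of the argument, and so the property passes to averages of shifted
  copies of \<open>f\<close>.\<close>

definition has_convex_fourth_derivative :: "(real \<Rightarrow> real) \<Rightarrow> bool" where
  "has_convex_fourth_derivative f \<longleftrightarrow>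
    (\<exists>f1 f2 f3 f4. (\<forall>x. (f has_real_derivative f1 x) (at x)) \<and>
      (\<forall>x. (f1 has_real_derivative f2 x) (at x)) \<and>
      (\<forall>x. (f2 has_real_derivative f3 x) (at x)) \<and>
      (\<forall>x. (f3 has_real_derivative f4 x) (at x)) \<and> convex_on UNIV f4)"

lemma deriv_even_is_odd:
  fixes f f' :: "real \<Rightarrow> real"
  assumes d: "\<And>x. (f has_real_derivative f' x) (at x)" and even: "\<And>x. f (- x) = f x"
  shows "f' (- x) = - f' x"
proof -
  have "((\<lambda>x. f (- x)) has_real_derivative f' (- x) * (- 1)) (at x)"
    by (rule DERIV_chain2[OF d]) (auto intro!: derivative_eq_intros)
  then have "(f has_real_derivative - f' (- x)) (at x)" by (simp add: even)
  from DERIV_unique[OF this d] show ?thesis by simp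
qed

lemma deriv_odd_is_even:
  fixes f f' :: "real \<Rightarrow> real"
  assumes d: "\<And>x. (f has_real_derivative f' x) (at x)" and odd: "\<And>x. f (- x) = - f x"
  shows "f' (- x) = f' x"
proof -
  have "((\<lambda>x. f (- x)) has_real_derivative f' (- x) * (- 1)) (at x)"
    by (rule DERIV_chain2[OF d]) (auto intro!: derivative_eq_intros)
  then have "((\<lambda>x. - f x) has_real_derivative - f' (- x)) (at x)" by (simp add: odd)
  from DERIV_minus[OF this] have "(f has_real_derivative f' (- x)) (at x)" by simp
  from DERIV_unique[OF this d] show ?thesis by simp
qed

lemma even_convex_mono:
  fixes g :: "real \<Rightarrow> real"
  assumes conv: "convex_on UNIV g" and even: "\<And>x. g (- x) = g x" and "0 \<le> x" "x \<le> y"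
  shows "g x \<le> g y"
proof (cases "y = 0")
  case False
  define t where "t = (y - x) / (2 * y)"
  have t: "0 \<le> t" "t \<le> 1" using assms False by (auto simp: t_def field_simps)
  have x: "x = (1 - t) * y + t * (- y)" using False by (simp add: t_def field_simps)
  have "g ((1 - t) *\<^sub>R y + t *\<^sub>R (- y)) \<le> (1 - t) * g y + t * g (- y)"
    by (rule convex_onD[OF conv t]) auto
  also have "\<dots> = g y" by (simp add: even algebra_simps)
  finally show ?thesis using x by simp
qed (use assms in auto)

text \<open>Divided by \<open>8 * s ^ 5\<close>, the expression is the third derivative at \<open>v = s\<^sup>2\<close> of
  \<open>\<lambda>v. sqrt v * f1 (sqrt v)\<close>. It is nonnegative because it equals
  \<open>s ^ 3 * f4 s\<close> minus three times the integral of \<open>t * f3 t\<close> over \<open>[0, s]\<close>, and \<open>f3 t \<le> t * f4 s\<close> there.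
  The function \<open>\<phi>\<close> in the proof, with \<open>f4 s\<close> held constant, replaces that integral.\<close>

lemma fourth_derivative_inequality:
  fixes f1 f2 f3 f4 :: "real \<Rightarrow> real"
  assumes d2: "\<And>x. (f1 has_real_derivative f2 x) (at x)"
    and d3: "\<And>x. (f2 has_real_derivative f3 x) (at x)"
    and d4: "\<And>x. (f3 has_real_derivative f4 x) (at x)"
    and zero: "f1 0 = 0" "f3 0 = 0"
    and mono: "\<And>x y. 0 \<le> x \<Longrightarrow> x \<le> y \<Longrightarrow> f4 x \<le> f4 y"
    and s: "0 \<le> s"
  shows "0 \<le> s ^ 3 * f4 s - 3 * s * f2 s + 3 * f1 s"
proof -
  have f3_le: "f3 t \<le> t * f4 s" if t: "0 \<le> t" "t \<le> s" for t
  proof (cases "t = 0")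
    case False
    then obtain z where z: "0 < z" "z < t" "f3 t - f3 0 = (t - 0) * f4 z"
      using MVT2[of 0 t f3 f4] t d4 by auto
    have "f4 z \<le> f4 s" using z t by (intro mono) auto
    then show ?thesis using z t zero by (simp add: mult_left_mono)
  qed (use zero in simp)
  define \<phi> where "\<phi> t = t ^ 3 * f4 s - 3 * t * f2 t + 3 * f1 t" for t
  have "\<phi> 0 \<le> \<phi> s"
  proof (rule DERIV_nonneg_imp_nondecreasing[OF s])
    fix t assume t: "0 \<le> t" "t \<le> s"
    have "(\<phi> has_real_derivative 3 * t * (t * f4 s - f3 t)) (at t)"
      unfolding \<phi>_def by (auto intro!: derivative_eq_intros d2 d3 simp: algebra_simps power2_eq_square)
    moreover have "0 \<le> 3 * t * (t * f4 s - f3 t)" using f3_le[OF t] t by simp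
    ultimately show "\<exists>y. (\<phi> has_real_derivative y) (at t) \<and> 0 \<le> y" by blast
  qed
  then show ?thesis using zero by (simp add: \<phi>_def)
qed

text \<open>Weights that annihilate all quadratic polynomials form a multiple of the third divided difference,
  and \<open>0 \<le> w4\<close> fixes the sign of the multiple. By Rolle's theorem the difference equals a value of
  \<open>H3 / 6\<close>. Derivatives are asked for only to the
  right of \<open>x1\<close>, because in the application \<open>x1\<close> can be \<open>0\<close>, where the square root is not differentiable.\<close>

lemma third_difference_nonneg:
  fixes H H1 H2 H3 :: "real \<Rightarrow> real"
  assumes less: "x1 < x2" "x2 < x3" "x3 < x4"
    and cont: "continuous_on {x1..x4} H"
    and d1: "\<And>x. x1 < x \<Longrightarrow> (H has_real_derivative H1 x) (at x)"
    and d2: "\<And>x. x1 < x \<Longrightarrow> (H1 has_real_derivative H2 x) (at x)"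
    and d3: "\<And>x. x1 < x \<Longrightarrow> (H2 has_real_derivative H3 x) (at x)"
    and nonneg: "\<And>x. x1 < x \<Longrightarrow> 0 \<le> H3 x"
    and w: "w1 + w2 + w3 + w4 = 0"
      "w1 * x1 + w2 * x2 + w3 * x3 + w4 * x4 = 0"
      "w1 * x1\<^sup>2 + w2 * x2\<^sup>2 + w3 * x3\<^sup>2 + w4 * x4\<^sup>2 = 0" "0 \<le> w4"
  shows "0 \<le> w1 * H x1 + w2 * H x2 + w3 * H x3 + w4 * H x4"
proof -
  \<comment> \<open>\<open>q\<close> interpolates \<open>H\<close> at \<open>x1\<close>, \<open>x2\<close>, \<open>x3\<close>; adding \<open>\<delta> * r\<close> also matches \<open>x4\<close>.\<close>
  define b where "b = (H x2 - H x1) / (x2 - x1)"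
  define c where "c = (H x3 - H x1 - b * (x3 - x1)) / ((x3 - x1) * (x3 - x2))"
  define q where "q x = H x1 + b * (x - x1) + c * ((x - x1) * (x - x2))" for x
  define r where "r x = (x - x1) * (x - x2) * (x - x3)" for x
  define \<delta> where "\<delta> = (H x4 - q x4) / r x4"
  define \<psi> where "\<psi> x = H x - q x - \<delta> * r x" for x
  define \<psi>1 where "\<psi>1 x = H1 x - (b + c * (2 * x - x1 - x2))
      - \<delta> * ((x - x2) * (x - x3) + (x - x1) * (x - x3) + (x - x1) * (x - x2))" for x
  define \<psi>2 where "\<psi>2 x = H2 x - 2 * c - \<delta> * (6 * x - 2 * x1 - 2 * x2 - 2 * x3)" for x
  have q: "q x1 = H x1" "q x2 = H x2" "q x3 = H x3"
    using less by (simp_all add: q_def b_def c_def)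
  have r4: "r x4 > 0" using less by (simp add: r_def)
  have zeros: "\<psi> x1 = 0" "\<psi> x2 = 0" "\<psi> x3 = 0" "\<psi> x4 = 0"
    using q r4 by (simp_all add: \<psi>_def r_def[of x1] r_def[of x2] r_def[of x3] \<delta>_def)
  have D1: "(\<psi> has_real_derivative \<psi>1 x) (at x)" if "x1 < x" for x
    unfolding \<psi>_def \<psi>1_def q_def r_def
    by (rule derivative_eq_intros d1 that refl)+ (simp add: algebra_simps)
  have D2: "(\<psi>1 has_real_derivative \<psi>2 x) (at x)" if "x1 < x" for x
    unfolding \<psi>1_def \<psi>2_def
    by (rule derivative_eq_intros d2 that refl)+ (simp add: algebra_simps)
  have D3: "(\<psi>2 has_real_derivative (H3 x - 6 * \<delta>)) (at x)" if "x1 < x" for x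
    unfolding \<psi>2_def
    by (rule derivative_eq_intros d3 that refl)+ (simp add: algebra_simps)
  have cont_\<psi>: "continuous_on {x1..x4} \<psi>"
    unfolding \<psi>_def q_def r_def by (intro continuous_intros cont)
  have rolle: "\<exists>z. u < z \<and> z < v \<and> g' z = 0"
    if "u < v" "g u = g v" "continuous_on {u..v} g"
      "\<And>x. u < x \<Longrightarrow> (g has_real_derivative g' x) (at x)" for u v :: real and g g'
  proof -
    have "\<exists>z. u < z \<and> z < v \<and> (*) (g' z) = (\<lambda>v. 0)"
      by (rule Rolle_deriv[OF that(1-3)]) (use that(4) in \<open>simp add: has_field_derivative_def\<close>)
    then show ?thesis by (metis mult.right_neutral)
  qed
  have C1: "continuous_on {u..v} \<psi>1" if "x1 < u" for u v
    using D2 that by (meson DERIV_isCont atLeastAtMost_iff continuous_at_imp_continuous_on less_le_trans)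
  have C2: "continuous_on {u..v} \<psi>2" if "x1 < u" for u v
    using D3 that by (meson DERIV_isCont atLeastAtMost_iff continuous_at_imp_continuous_on less_le_trans)
  obtain y1 where y1: "x1 < y1" "y1 < x2" "\<psi>1 y1 = 0"
    using rolle[of x1 x2 \<psi> \<psi>1] zeros less D1 continuous_on_subset[OF cont_\<psi>, of "{x1..x2}"] by auto
  obtain y2 where y2: "x2 < y2" "y2 < x3" "\<psi>1 y2 = 0"
    using rolle[of x2 x3 \<psi> \<psi>1] zeros less D1 continuous_on_subset[OF cont_\<psi>, of "{x2..x3}"] by auto
  obtain y3 where y3: "x3 < y3" "y3 < x4" "\<psi>1 y3 = 0"
    using rolle[of x3 x4 \<psi> \<psi>1] zeros less D1 continuous_on_subset[OF cont_\<psi>, of "{x3..x4}"] by auto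
  obtain z1 where z1: "y1 < z1" "z1 < y2" "\<psi>2 z1 = 0"
    using rolle[of y1 y2 \<psi>1 \<psi>2] y1 y2 less D2 C1 by auto
  obtain z2 where z2: "y2 < z2" "z2 < y3" "\<psi>2 z2 = 0"
    using rolle[of y2 y3 \<psi>1 \<psi>2] y2 y3 less D2 C1 by auto
  obtain \<xi> where \<xi>: "z1 < \<xi>" "\<xi> < z2" "H3 \<xi> - 6 * \<delta> = 0"
    using rolle[of z1 z2 \<psi>2 "\<lambda>x. H3 x - 6 * \<delta>"] z1 z2 y1 less D3 C2 by auto
  then have "\<delta> \<ge> 0" using nonneg[of \<xi>] z1 y1 by linarith
  have "w1 * q x1 + w2 * q x2 + w3 * q x3 + w4 * q x4 =
      (H x1 - b * x1 + c * x1 * x2) * (w1 + w2 + w3 + w4) +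
      (b - c * (x1 + x2)) * (w1 * x1 + w2 * x2 + w3 * x3 + w4 * x4) +
      c * (w1 * x1\<^sup>2 + w2 * x2\<^sup>2 + w3 * x3\<^sup>2 + w4 * x4\<^sup>2)"
    unfolding q_def by algebra
  also have "\<dots> = 0" by (simp add: w)
  finally have "w1 * H x1 + w2 * H x2 + w3 * H x3 + w4 * H x4 = w4 * (H x4 - q x4)"
    unfolding q by (simp add: algebra_simps)
  also have "\<dots> = w4 * (\<delta> * r x4)" using r4 by (simp add: \<delta>_def)
  also have "\<dots> \<ge> 0" using \<open>\<delta> \<ge> 0\<close> r4 w by simp
  finally show ?thesis .
qed

text \<open>For \<open>a > b > c > 0\<close> the four weights, read as weights at the squares of \<open>a + b + c\<close>,
  \<open>a + b - c\<close>, \<open>a - b + c\<close> and \<open>- a + b + c\<close>, annihilate \<open>1\<close>, \<open>v\<close> and \<open>v\<^sup>2\<close>. The sum is therefore a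
  positive multiple of the third divided difference of \<open>v \<mapsto> sqrt v * f1 (sqrt v)\<close> at these squares.\<close>

lemma exchange_derivative_nonneg:
  fixes f1 f2 f3 f4 :: "real \<Rightarrow> real"
  assumes d2: "\<And>x. (f1 has_real_derivative f2 x) (at x)"
    and d3: "\<And>x. (f2 has_real_derivative f3 x) (at x)"
    and d4: "\<And>x. (f3 has_real_derivative f4 x) (at x)"
    and conv: "convex_on UNIV f4" and odd: "\<And>x. f1 (- x) = - f1 x"
    and abc: "b < a" "c < b" "0 < c"
  defines "h \<equiv> \<lambda>s. s * f1 s"
  shows "0 \<le> (a - b) * (b - c) * (a - c) * h (a + b + c)
    - (a - b) * (b + c) * (a + c) * h (a + b - c)
    + (a + b) * (b + c) * (a - c) * h (a - b + c)
    - (a + b) * (b - c) * (a + c) * h (- a + b + c)"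
proof -
  have even2: "f2 (- x) = f2 x" for x by (rule deriv_odd_is_even[OF d2 odd])
  have odd3: "f3 (- x) = - f3 x" for x by (rule deriv_even_is_odd[OF d3 even2])
  have even4: "f4 (- x) = f4 x" for x by (rule deriv_odd_is_even[OF d4 odd3])
  have zero: "f1 0 = 0" "f3 0 = 0" using odd[of 0] odd3[of 0] by auto
  define H where "H v = h (sqrt v)" for v
  have H: "H (t\<^sup>2) = h t" for t by (cases "t \<ge> 0") (auto simp: H_def h_def odd)
  \<comment> \<open>\<open>k1\<close>, \<open>k2\<close>, \<open>k3\<close> are the successive derivatives of \<open>H\<close> in \<open>v\<close>, written in terms of \<open>s = sqrt v\<close>.\<close>
  define k1 where "k1 s = (f1 s / s + f2 s) / 2" for s
  define k2 where "k2 s = (f3 s / s + f2 s / s^2 - f1 s / s^3) / 4" for s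
  define k3 where "k3 s = (s ^ 3 * f4 s - 3 * s * f2 s + 3 * f1 s) / (8 * s ^ 5)" for s
  have chain: "((\<lambda>v. g (sqrt v)) has_real_derivative g' (sqrt v)) (at v)"
    if "0 < v" "\<And>s. 0 < s \<Longrightarrow> (g has_real_derivative 2 * s * g' s) (at s)"
    for g g' :: "real \<Rightarrow> real" and v
  proof -
    have "((\<lambda>v. g (sqrt v)) has_real_derivative (2 * sqrt v * g' (sqrt v)) * (inverse (sqrt v) / 2)) (at v)"
      by (rule DERIV_chain2[OF that(2) DERIV_real_sqrt]) (use that in auto)
    then show ?thesis using that by (simp add: field_simps)
  qed
  have K1: "(h has_real_derivative 2 * s * k1 s) (at s)" if "0 < s" for s
    unfolding h_def k1_def using that
    by (auto intro!: derivative_eq_intros d2 simp: field_simps)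
  have K2: "(k1 has_real_derivative 2 * s * k2 s) (at s)" if "0 < s" for s
    unfolding k1_def k2_def using that
    by (auto intro!: derivative_eq_intros d2 d3 simp: field_simps power2_eq_square power3_eq_cube)
  have K3: "(k2 has_real_derivative 2 * s * k3 s) (at s)" if "0 < s" for s
    unfolding k2_def k3_def using that
    by (auto intro!: derivative_eq_intros d2 d3 d4 simp: field_simps eval_nat_numeral)
  have k3: "0 \<le> k3 s" if "0 < s" for s
    unfolding k3_def using fourth_derivative_inequality[OF d2 d3 d4 zero even_convex_mono[OF conv even4], of s] that
    by simp
  have lt: "(- a + b + c)\<^sup>2 < (a - b + c)\<^sup>2" "(a - b + c)\<^sup>2 < (a + b - c)\<^sup>2"
    "(a + b - c)\<^sup>2 < (a + b + c)\<^sup>2"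
  proof -
    have "(a - b + c)\<^sup>2 - (- a + b + c)\<^sup>2 = 4 * c * (a - b)" by (simp add: power2_eq_square algebra_simps)
    moreover have "(a + b - c)\<^sup>2 - (a - b + c)\<^sup>2 = 4 * a * (b - c)" by (simp add: power2_eq_square algebra_simps)
    moreover have "(a + b + c)\<^sup>2 - (a + b - c)\<^sup>2 = 4 * (a + b) * c" by (simp add: power2_eq_square algebra_simps)
    moreover have "0 < 4 * c * (a - b)" "0 < 4 * a * (b - c)" "0 < 4 * (a + b) * c" using abc by simp_all
    ultimately show "(- a + b + c)\<^sup>2 < (a - b + c)\<^sup>2" "(a - b + c)\<^sup>2 < (a + b - c)\<^sup>2"
    "(a + b - c)\<^sup>2 < (a + b + c)\<^sup>2" by linarith+
  qed
  have pos: "0 < x" if "(- a + b + c)\<^sup>2 < x" for x by (rule le_less_trans[OF _ that]) simp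
  have f1c: "continuous_on S f1" for S
    using d2 by (meson DERIV_isCont continuous_at_imp_continuous_on)
  have "0 \<le> - ((a + b) * (b - c) * (a + c)) * H ((- a + b + c)\<^sup>2)
    + (a + b) * (b + c) * (a - c) * H ((a - b + c)\<^sup>2)
    + - ((a - b) * (b + c) * (a + c)) * H ((a + b - c)\<^sup>2)
    + (a - b) * (b - c) * (a - c) * H ((a + b + c)\<^sup>2)"
  proof (rule third_difference_nonneg[OF lt, of H "\<lambda>v. k1 (sqrt v)" "\<lambda>v. k2 (sqrt v)" "\<lambda>v. k3 (sqrt v)"])
    show "continuous_on {(- a + b + c)\<^sup>2..(a + b + c)\<^sup>2} H"
      unfolding H_def h_def
      by (intro continuous_intros continuous_on_compose2[OF f1c[of UNIV]]) auto
    show "(H has_real_derivative k1 (sqrt x)) (at x)" if "(- a + b + c)\<^sup>2 < x" for x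
      unfolding H_def by (rule chain[OF pos[OF that] K1])
    show "((\<lambda>v. k1 (sqrt v)) has_real_derivative k2 (sqrt x)) (at x)" if "(- a + b + c)\<^sup>2 < x" for x
      by (rule chain[OF pos[OF that] K2])
    show "((\<lambda>v. k2 (sqrt v)) has_real_derivative k3 (sqrt x)) (at x)" if "(- a + b + c)\<^sup>2 < x" for x
      by (rule chain[OF pos[OF that] K3])
    show "0 \<le> k3 (sqrt x)" if "(- a + b + c)\<^sup>2 < x" for x
      using k3 pos[OF that] by simp
    show "0 \<le> (a - b) * (b - c) * (a - c)" using abc by simp
  qed algebra+
  then show ?thesis unfolding H mult_minus_left by linarith
qed

lemma has_convex_fourth_derivative_average:
  assumes "has_convex_fourth_derivative f"
  shows "has_convex_fourth_derivative (\<lambda>x. (f (x + c) + f (x - c)) / 2)"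
proof -
  obtain f1 f2 f3 f4 where
    d: "\<And>x. (f has_real_derivative f1 x) (at x)" "\<And>x. (f1 has_real_derivative f2 x) (at x)"
    "\<And>x. (f2 has_real_derivative f3 x) (at x)" "\<And>x. (f3 has_real_derivative f4 x) (at x)"
    and conv: "convex_on UNIV f4"
    using assms unfolding has_convex_fourth_derivative_def by blast
  have D: "((\<lambda>x. (g (x + c) + g (x - c)) / 2) has_real_derivative (g' (x + c) + g' (x - c)) / 2) (at x)"
    if "\<And>x. (g has_real_derivative g' x) (at x)" for g g' :: "real \<Rightarrow> real" and x
  proof -
    have "((\<lambda>x. g (x + c)) has_real_derivative g' (x + c) * 1) (at x)"
      by (rule DERIV_chain2[OF that]) (auto intro!: derivative_eq_intros)
    moreover have "((\<lambda>x. g (x - c)) has_real_derivative g' (x - c) * 1) (at x)"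
      by (rule DERIV_chain2[OF that]) (auto intro!: derivative_eq_intros)
    ultimately show ?thesis
      using DERIV_cdivide[OF DERIV_add] by fastforce
  qed
  have shift: "convex_on UNIV (\<lambda>x. f4 (x + r))" for r
  proof (rule convex_onI)
    fix t x y :: real assume t: "0 < t" "t < 1"
    have e: "(1 - t) *\<^sub>R x + t *\<^sub>R y + r = (1 - t) *\<^sub>R (x + r) + t *\<^sub>R (y + r)"
      by (simp add: algebra_simps)
    show "f4 ((1 - t) *\<^sub>R x + t *\<^sub>R y + r) \<le> (1 - t) * f4 (x + r) + t * f4 (y + r)"
      unfolding e by (rule convex_onD[OF conv]) (use t in auto)
  qed simp
  have "convex_on UNIV (\<lambda>x. (f4 (x + c) + f4 (x - c)) / 2)"
    using convex_on_cdiv[OF _ convex_on_add[OF shift[of c] shift[of "- c"]], of 2] by simp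
  then show ?thesis
    unfolding has_convex_fourth_derivative_def
    by (intro exI[of _ "\<lambda>x. (f1 (x + c) + f1 (x - c)) / 2"] exI[of _ "\<lambda>x. (f2 (x + c) + f2 (x - c)) / 2"]
        exI[of _ "\<lambda>x. (f3 (x + c) + f3 (x - c)) / 2"] exI[of _ "\<lambda>x. (f4 (x + c) + f4 (x - c)) / 2"]
        conjI allI D d)
qed

section \<open>Exchanging three coefficients\<close>

text \<open>The sum over all eight choices of signs is twice this one when \<open>f\<close> is even.\<close>

definition sign_sum3 :: "(real \<Rightarrow> real) \<Rightarrow> real \<Rightarrow> real \<Rightarrow> real \<Rightarrow> real" where
  "sign_sum3 f a b c = f (a + b + c) + f (a + b - c) + f (a - b + c) + f (- a + b + c)"

text \<open>The numbers \<open>u\<close> are the squares of three coefficients. Their first two power sums fix a circle, on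
  which the third power sum is largest when the two smaller coordinates coincide. The proof walks along
  the circle to that point, starting from \<open>(u1, u2, u3)\<close>, and
  \<open>exchange_derivative_nonneg\<close> shows that the sign sum does not decrease on the way. The strict growth of the
  third power sum serves as a progress measure, since the sign sum itself may stay constant.\<close>

lemma exchange_three:
  fixes f :: "real \<Rightarrow> real"
  assumes f: "has_convex_fourth_derivative f" and even: "\<And>x. f (- x) = f x"
    and u: "u2 \<le> u1" "u3 < u2" "0 \<le> u3"
  obtains v w where "0 \<le> w" "0 \<le> v" "v + 2 * w = u1 + u2 + u3"
    "v\<^sup>2 + 2 * w\<^sup>2 = u1\<^sup>2 + u2\<^sup>2 + u3\<^sup>2" "v ^ 3 + 2 * w ^ 3 > u1 ^ 3 + u2 ^ 3 + u3 ^ 3"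
    "sign_sum3 f (sqrt u1) (sqrt u2) (sqrt u3) \<le> sign_sum3 f (sqrt v) (sqrt w) (sqrt w)"
proof -
  obtain f1 f2 f3 f4 where
    d1: "\<And>x. (f has_real_derivative f1 x) (at x)" and
    d2: "\<And>x. (f1 has_real_derivative f2 x) (at x)" and
    d3: "\<And>x. (f2 has_real_derivative f3 x) (at x)" and
    d4: "\<And>x. (f3 has_real_derivative f4 x) (at x)" and conv: "convex_on UNIV f4"
    using f unfolding has_convex_fourth_derivative_def by blast
  have odd: "f1 (- x) = - f1 x" for x by (rule deriv_even_is_odd[OF d1 even])
  \<comment> \<open>The circle is parametrized by half the gap of the two smaller coordinates: \<open>z\<close> runs from \<open>z0\<close>,
    the given point, down to \<open>0\<close>. The mean \<open>m\<close> and the squared radius, a multiple of \<open>R\<close>, stay fixed.\<close>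
  define m where "m = (u1 + u2 + u3) / 3"
  define z0 where "z0 = (u2 - u3) / 2"
  define X0 where "X0 = (2 * u1 - u2 - u3) / 3"
  define R where "R = X0\<^sup>2 + 4 / 3 * z0\<^sup>2"
  define X where "X z = sqrt (R - 4 / 3 * z\<^sup>2)" for z
  define U1 where "U1 z = m + X z" for z
  define U2 where "U2 z = m - X z / 2 + z" for z
  define U3 where "U3 z = m - X z / 2 - z" for z
  have z0: "0 < z0" and X0: "0 < X0" and zX: "z0 \<le> 3 / 2 * X0"
    using u by (auto simp: z0_def X0_def field_simps)
  have Xarg: "X0\<^sup>2 \<le> R - 4 / 3 * z\<^sup>2" if "0 \<le> z" "z \<le> z0" for z
    using power_mono[OF that(2,1), of 2] by (simp add: R_def)
  have X_ge: "X0 \<le> X z" if "0 \<le> z" "z \<le> z0" for z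
    unfolding X_def by (rule real_le_rsqrt) (rule Xarg[OF that])
  have X_sq: "(X z)\<^sup>2 = R - 4 / 3 * z\<^sup>2" if "0 \<le> z" "z \<le> z0" for z
    unfolding X_def using Xarg[OF that] zero_le_power2[of X0] by (intro real_sqrt_pow2) linarith
  have X_end: "X z0 = X0" using X0 by (simp add: X_def R_def)
  have U_end: "U1 z0 = u1" "U2 z0 = u2" "U3 z0 = u3"
    unfolding U1_def U2_def U3_def X_end by (simp_all add: m_def z0_def X0_def field_simps)
  have U3_gt: "u3 < U3 z" if z: "0 \<le> z" "z < z0" for z
  proof -
    have "(X z - X0) * (X z + X0) = 4 / 3 * (z0\<^sup>2 - z\<^sup>2)"
      using X_sq[of z] z by (simp add: R_def algebra_simps power2_eq_square)
    also have "\<dots> = 2 * (z0 - z) * (2 / 3 * (z0 + z))" by (simp add: power2_eq_square algebra_simps)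
    also have "\<dots> < 2 * (z0 - z) * (X z + X0)"
      using X_ge[of z] z zX by (intro mult_strict_left_mono) auto
    finally have "X z - X0 < 2 * (z0 - z)"
      using X_ge[of z] z X0 by (simp add: mult_less_cancel_right)
    then have "U3 z0 < U3 z" unfolding U3_def X_end by simp
    then show ?thesis by (simp add: U_end)
  qed
  have U23: "U3 z < U2 z" if "0 < z" for z using that by (simp add: U2_def U3_def)
  have U12: "U2 z < U1 z" if "0 \<le> z" "z < z0" for z
    using X_ge[of z] that zX by (simp add: U1_def U2_def)
  define F where "F z = sign_sum3 f (sqrt (U1 z)) (sqrt (U2 z)) (sqrt (U3 z))" for z
  have "F z0 \<le> F 0"
  proof (rule DERIV_nonpos_imp_decreasing_open[of 0 z0 F])
    show "0 \<le> z0" using z0 by simp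
    have fc: "continuous_on UNIV f" using d1 by (meson DERIV_isCont continuous_at_imp_continuous_on)
    show "continuous_on {0..z0} F"
      unfolding F_def sign_sum3_def U1_def U2_def U3_def X_def
      by (intro continuous_intros continuous_on_compose2[OF fc]) auto
    fix z assume z: "0 < z" "z < z0"
    define a where "a = sqrt (U1 z)"
    define b where "b = sqrt (U2 z)"
    define c where "c = sqrt (U3 z)"
    have Xpos: "0 < X z" using X_ge[of z] X0 z by simp
    have Upos: "0 < U3 z" "0 < U2 z" "0 < U1 z" using U3_gt[of z] U23[of z] U12[of z] z u by auto
    have abc: "b < a" "c < b" "0 < c"
      using U23[of z] U12[of z] z Upos by (auto simp: a_def b_def c_def)
    have sq: "a\<^sup>2 = U1 z" "b\<^sup>2 = U2 z" "c\<^sup>2 = U3 z" using Upos by (auto simp: a_def b_def c_def)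
    \<comment> \<open>The tangent of the circle is a multiple of \<open>(U2 - U3, U3 - U1, U1 - U2)\<close>.\<close>
    define \<kappa> where "\<kappa> = - 1 / (3 * X z)"
    have arg: "0 < R - 4 / 3 * z\<^sup>2" using Xarg[of z] z X0 by (smt (verit) zero_less_power)
    have "((\<lambda>z. R - 4 / 3 * z\<^sup>2) has_real_derivative - (8 / 3 * z)) (at z)"
      by (auto intro!: derivative_eq_intros)
    from DERIV_chain2[OF DERIV_real_sqrt[OF arg] this]
    have "(X has_real_derivative inverse (sqrt (R - 4 / 3 * z\<^sup>2)) / 2 * - (8 / 3 * z)) (at z)"
      unfolding X_def .
    then have DX: "(X has_real_derivative (- 4 / 3 * z / X z)) (at z)"
      unfolding X_def[of z, symmetric] using Xpos by (simp add: field_simps)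
    have DU: "(U1 has_real_derivative 2 * \<kappa> * (b\<^sup>2 - c\<^sup>2)) (at z)"
        "(U2 has_real_derivative 2 * \<kappa> * (c\<^sup>2 - a\<^sup>2)) (at z)"
        "(U3 has_real_derivative 2 * \<kappa> * (a\<^sup>2 - b\<^sup>2)) (at z)"
      unfolding sq unfolding U1_def U2_def U3_def \<kappa>_def using Xpos
      by (auto intro!: derivative_eq_intros DX simp: field_simps)
    have Dsqrt: "((\<lambda>z. sqrt (U z)) has_real_derivative \<kappa> * d / sqrt (U z)) (at z)"
      if "(U has_real_derivative 2 * \<kappa> * d) (at z)" "0 < U z" for U d
    proof -
      have "((\<lambda>z. sqrt (U z)) has_real_derivative inverse (sqrt (U z)) / 2 * (2 * \<kappa> * d)) (at z)"
        by (rule DERIV_chain2[OF DERIV_real_sqrt that(1)]) (rule that(2))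
      then show ?thesis by (simp add: field_simps)
    qed
    note Da = Dsqrt[OF DU(1) Upos(3), folded a_def]
     and Db = Dsqrt[OF DU(2) Upos(2), folded b_def]
     and Dc = Dsqrt[OF DU(3) Upos(1), folded c_def]
    define a' where "a' = \<kappa> * (b\<^sup>2 - c\<^sup>2) / a"
    define b' where "b' = \<kappa> * (c\<^sup>2 - a\<^sup>2) / b"
    define c' where "c' = \<kappa> * (a\<^sup>2 - b\<^sup>2) / c"
    have DF: "(F has_real_derivative f1 (a + b + c) * (a' + b' + c') + f1 (a + b - c) * (a' + b' - c')
       + f1 (a - b + c) * (a' - b' + c') + f1 (- a + b + c) * (- a' + b' + c')) (at z)"
      unfolding F_def sign_sum3_def a_def b_def c_def a'_def b'_def c'_def
      by (intro DERIV_add DERIV_diff DERIV_minus DERIV_chain2[OF d1]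
          Da[unfolded a_def b_def c_def] Db[unfolded a_def b_def c_def] Dc[unfolded a_def b_def c_def])
    have e: "f1 (a + b + c) * (a' + b' + c') + f1 (a + b - c) * (a' + b' - c')
       + f1 (a - b + c) * (a' - b' + c') + f1 (- a + b + c) * (- a' + b' + c') =
      \<kappa> / (a * b * c) * ((a - b) * (b - c) * (a - c) * ((a + b + c) * f1 (a + b + c))
    - (a - b) * (b + c) * (a + c) * ((a + b - c) * f1 (a + b - c))
    + (a + b) * (b + c) * (a - c) * ((a - b + c) * f1 (a - b + c))
    - (a + b) * (b - c) * (a + c) * ((- a + b + c) * f1 (- a + b + c)))"
    proof -
      \<comment> \<open>If two coefficients agree, the left side is \<open>0\<close>, which accounts for the three
        differences. The other identities follow by changing the sign of one coefficient.\<close>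
      have s1: "a' + b' + c' = \<kappa> / (a * b * c) * ((a - b) * (b - c) * (a - c) * (a + b + c))"
        using abc unfolding a'_def b'_def c'_def by (simp add: field_simps) algebra
      have s2: "a' + b' - c' = \<kappa> / (a * b * c) * (- ((a - b) * (b + c) * (a + c) * (a + b - c)))"
        using abc unfolding a'_def b'_def c'_def by (simp add: field_simps) algebra
      have s3: "a' - b' + c' = \<kappa> / (a * b * c) * ((a + b) * (b + c) * (a - c) * (a - b + c))"
        using abc unfolding a'_def b'_def c'_def by (simp add: field_simps) algebra
      have s4: "- a' + b' + c' = \<kappa> / (a * b * c) * (- ((a + b) * (b - c) * (a + c) * (- a + b + c)))"
        using abc unfolding a'_def b'_def c'_def by (simp add: field_simps) algebra
      show ?thesis unfolding s1 s2 s3 s4 by algebra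
    qed
    have "\<kappa> / (a * b * c) \<le> 0" using abc Xpos by (simp add: \<kappa>_def field_simps)
    from mult_nonpos_nonneg[OF this exchange_derivative_nonneg[OF d2 d3 d4 conv odd abc]]
    show "\<exists>y. (F has_real_derivative y) (at z) \<and> y \<le> 0"
      using DF unfolding e by blast
  qed
  define \<rho> where "\<rho> = X 0"
  have \<rho>: "\<rho>\<^sup>2 = X0\<^sup>2 + 4 / 3 * z0\<^sup>2" using X_sq[of 0] z0 by (simp add: \<rho>_def R_def)
  have "X0\<^sup>2 < \<rho>\<^sup>2" using z0 by (simp add: \<rho>)
  then have \<rho>X: "X0 < \<rho>" using X_ge[of 0] z0 X0 by (smt (verit) \<rho>_def)
  have us: "u1 = m + X0" "u2 = m - X0 / 2 + z0" "u3 = m - X0 / 2 - z0"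
    using U_end unfolding U1_def U2_def U3_def X_end by auto
  have sums: "u1 + u2 + u3 = 3 * m" by (simp add: us)
  show thesis
  proof (rule that[of "m - \<rho> / 2" "m + \<rho>"])
    show "0 \<le> m - \<rho> / 2" using U3_gt[of 0] z0 u by (simp add: U3_def \<rho>_def)
    then show "0 \<le> m + \<rho>" using \<rho>X X0 by simp
    show "m + \<rho> + 2 * (m - \<rho> / 2) = u1 + u2 + u3" by (simp add: sums)
    show "(m + \<rho>)\<^sup>2 + 2 * (m - \<rho> / 2)\<^sup>2 = u1\<^sup>2 + u2\<^sup>2 + u3\<^sup>2"
      using \<rho> unfolding us by (simp add: power2_eq_square field_simps)
    have "(m + \<rho>) ^ 3 + 2 * (m - \<rho> / 2) ^ 3 - (u1 ^ 3 + u2 ^ 3 + u3 ^ 3)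
       = 3 / 4 * (\<rho> - X0) * (2 * X0 + \<rho>)\<^sup>2"
    proof -
      have z: "z0\<^sup>2 = 3 / 4 * (\<rho>\<^sup>2 - X0\<^sup>2)" using \<rho> by simp
      have "(m + \<rho>) ^ 3 + 2 * (m - \<rho> / 2) ^ 3 - (u1 ^ 3 + u2 ^ 3 + u3 ^ 3)
        = 9 / 2 * m * \<rho>\<^sup>2 + 3 / 4 * \<rho> ^ 3 - 9 / 2 * m * X0\<^sup>2 - 3 / 4 * X0 ^ 3 - 6 * m * z0\<^sup>2 + 3 * X0 * z0\<^sup>2"
        unfolding us by (simp add: power2_eq_square power3_eq_cube field_simps)
      also have "\<dots> = 3 / 4 * (\<rho> - X0) * (2 * X0 + \<rho>)\<^sup>2"
        unfolding z by (simp add: power2_eq_square power3_eq_cube field_simps)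
      finally show ?thesis .
    qed
    moreover have "0 < 3 / 4 * (\<rho> - X0) * (2 * X0 + \<rho>)\<^sup>2" using \<rho>X X0 by simp
    ultimately show "u1 ^ 3 + u2 ^ 3 + u3 ^ 3 < (m + \<rho>) ^ 3 + 2 * (m - \<rho> / 2) ^ 3" by linarith
    show "sign_sum3 f (sqrt u1) (sqrt u2) (sqrt u3)
        \<le> sign_sum3 f (sqrt (m + \<rho>)) (sqrt (m - \<rho> / 2)) (sqrt (m - \<rho> / 2))"
      using \<open>F z0 \<le> F 0\<close> unfolding F_def U_end by (simp add: U1_def U2_def U3_def \<rho>_def)
  qed
qed

section \<open>Powers of the absolute value\<close>

lemma DERIV_abs_powr:
  fixes q :: real
  assumes "1 < q"
  shows "((\<lambda>x. \<bar>x\<bar> powr q) has_real_derivative q * (sgn x * \<bar>x\<bar> powr (q - 1))) (at x)"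
proof (cases x "0 :: real" rule: linorder_cases)
  case equal
  have "((\<lambda>h. \<bar>h\<bar> powr (q - 1)) \<longlongrightarrow> 0) (at (0::real))"
    using assms by (intro tendsto_eq_intros tendsto_powr' | simp)+
  then have "((\<lambda>h. norm ((\<bar>0 + h\<bar> powr q - \<bar>0\<bar> powr q) / h)) \<longlongrightarrow> 0) (at (0::real))"
    by (rule Lim_transform_eventually)
      (auto simp: eventually_at_filter powr_diff intro!: always_eventually)
  then have "((\<lambda>h. (\<bar>0 + h\<bar> powr q - \<bar>0\<bar> powr q) / h) \<longlongrightarrow> 0) (at (0::real))"
    by (rule tendsto_norm_zero_cancel)
  then show ?thesis using equal by (simp add: DERIV_def)
next
  case greater
  have "((\<lambda>x. x powr q) has_real_derivative q * x powr (q - 1)) (at x)"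
    using greater by (rule has_real_derivative_powr)
  then have "((\<lambda>x. \<bar>x\<bar> powr q) has_real_derivative q * x powr (q - 1)) (at x)"
    by (rule DERIV_cong_ev[THEN iffD1, rotated 3, OF _ refl _ refl])
      (use greater in \<open>auto intro: eventually_mono[OF eventually_nhds_in_open[of "{0<..}"]]\<close>)
  then show ?thesis using greater by simp
next
  case less
  have "((\<lambda>x. (- x) powr q) has_real_derivative q * (- x) powr (q - 1) * (- 1)) (at x)"
    by (rule DERIV_chain2[OF has_real_derivative_powr]) (use less in \<open>auto intro!: derivative_eq_intros\<close>)
  then have "((\<lambda>x. \<bar>x\<bar> powr q) has_real_derivative q * (- x) powr (q - 1) * (- 1)) (at x)"
    by (rule DERIV_cong_ev[THEN iffD1, rotated 3, OF _ refl _ refl])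
      (use less in \<open>auto intro: eventually_mono[OF eventually_nhds_in_open[of "{..<0}"]]\<close>)
  then show ?thesis using less by simp
qed

lemma DERIV_sgn_abs_powr:
  fixes q :: real
  assumes "1 < q"
  shows "((\<lambda>x. sgn x * \<bar>x\<bar> powr q) has_real_derivative q * \<bar>x\<bar> powr (q - 1)) (at x)"
proof (cases "x = 0")
  case True
  have "((\<lambda>h. \<bar>h\<bar> powr (q - 1)) \<longlongrightarrow> 0) (at (0::real))"
    using assms by (intro tendsto_eq_intros tendsto_powr' | simp)+
  then have "((\<lambda>h. (sgn (0 + h) * \<bar>0 + h\<bar> powr q - sgn 0 * \<bar>0\<bar> powr q) / h) \<longlongrightarrow> 0) (at (0::real))"
    by (rule Lim_transform_eventually)
      (auto simp: eventually_at_filter powr_diff sgn_if intro!: always_eventually)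
  then show ?thesis using True by (simp add: DERIV_def)
next
  case False
  have "((\<lambda>y. sgn x * \<bar>y\<bar> powr q) has_real_derivative sgn x * (q * (sgn x * \<bar>x\<bar> powr (q - 1)))) (at x)"
    by (intro DERIV_cmult DERIV_abs_powr assms)
  moreover have "sgn x * (q * (sgn x * \<bar>x\<bar> powr (q - 1))) = q * \<bar>x\<bar> powr (q - 1)"
    using False by (auto simp: sgn_if)
  moreover have "\<forall>\<^sub>F y in nhds x. sgn y = sgn x"
  proof (cases "x > 0")
    case True
    then show ?thesis by (auto intro!: eventually_mono[OF eventually_nhds_in_open[of "{0<..}"]])
  next
    case False
    with \<open>x \<noteq> 0\<close> show ?thesis by (auto intro!: eventually_mono[OF eventually_nhds_in_open[of "{..<0}"]])
  qed
  then have "\<forall>\<^sub>F y in nhds x. sgn x * \<bar>y\<bar> powr q = sgn y * \<bar>y\<bar> powr q"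
    by eventually_elim simp
  ultimately show ?thesis using DERIV_cong_ev[OF refl _ refl] by metis
qed

lemma convex_on_abs_powr:
  fixes q :: real
  assumes "1 \<le> q"
  shows "convex_on UNIV (\<lambda>x. \<bar>x\<bar> powr q)"
proof (cases "q = 1")
  case True
  have "convex_on UNIV (\<lambda>x::real. dist 0 x)" by (rule convex_on_dist) simp
  with True show ?thesis by (simp add: dist_real_def)
next
  case False
  with assms have q: "1 < q" by simp
  show ?thesis
  proof (rule convex_on_realI[OF _ DERIV_abs_powr[OF q]])
    fix x y :: real assume "x \<le> y"
    have "sgn x * \<bar>x\<bar> powr (q - 1) \<le> sgn y * \<bar>y\<bar> powr (q - 1)"
    proof (cases "0 \<le> x")
      case True
      then have "\<bar>x\<bar> powr (q - 1) \<le> \<bar>y\<bar> powr (q - 1)" using \<open>x \<le> y\<close> q by (intro powr_mono2) auto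
      then show ?thesis using True \<open>x \<le> y\<close> by (auto simp: sgn_if)
    next
      case False
      show ?thesis
      proof (cases "0 \<le> y")
        case True
        have "sgn x * \<bar>x\<bar> powr (q - 1) \<le> 0" using False by simp
        also have "0 \<le> sgn y * \<bar>y\<bar> powr (q - 1)" using True by (simp add: sgn_if)
        finally show ?thesis .
      next
        case neg: False
        then have "\<bar>y\<bar> powr (q - 1) \<le> \<bar>x\<bar> powr (q - 1)" using \<open>x \<le> y\<close> q by (intro powr_mono2) auto
        then show ?thesis using False neg by (simp add: sgn_if)
      qed
    qed
    then show "q * (sgn x * \<bar>x\<bar> powr (q - 1)) \<le> q * (sgn y * \<bar>y\<bar> powr (q - 1))"
      using q by (intro mult_left_mono) auto
  qed simp
qed

lemma has_convex_fourth_derivative_abs_powr: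
  fixes p :: real
  assumes "5 \<le> p"
  shows "has_convex_fourth_derivative (\<lambda>s. \<bar>s\<bar> powr p)"
  unfolding has_convex_fourth_derivative_def
proof (intro exI conjI allI)
  show "((\<lambda>s. \<bar>s\<bar> powr p) has_real_derivative p * (sgn x * \<bar>x\<bar> powr (p - 1))) (at x)" for x
    by (rule DERIV_abs_powr) (use assms in simp)
  show "((\<lambda>x. p * (sgn x * \<bar>x\<bar> powr (p - 1))) has_real_derivative
      p * ((p - 1) * \<bar>x\<bar> powr (p - 1 - 1))) (at x)" for x
    by (intro DERIV_cmult DERIV_sgn_abs_powr) (use assms in simp)
  show "((\<lambda>x. p * ((p - 1) * \<bar>x\<bar> powr (p - 1 - 1))) has_real_derivative
      p * ((p - 1) * ((p - 1 - 1) * (sgn x * \<bar>x\<bar> powr (p - 1 - 1 - 1))))) (at x)" for x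
    by (intro DERIV_cmult DERIV_abs_powr) (use assms in simp)
  show "((\<lambda>x. p * ((p - 1) * ((p - 1 - 1) * (sgn x * \<bar>x\<bar> powr (p - 1 - 1 - 1))))) has_real_derivative
      p * ((p - 1) * ((p - 1 - 1) * ((p - 1 - 1 - 1) * \<bar>x\<bar> powr (p - 1 - 1 - 1 - 1))))) (at x)" for x
    by (intro DERIV_cmult DERIV_sgn_abs_powr) (use assms in simp)
  show "convex_on UNIV
      (\<lambda>x. p * ((p - 1) * ((p - 1 - 1) * ((p - 1 - 1 - 1) * \<bar>x\<bar> powr (p - 1 - 1 - 1 - 1)))))"
    by (intro convex_on_cmul convex_on_abs_powr) (use assms in simp_all)
qed

section \<open>Averages over signs\<close>

text \<open>The expectation of \<open>f\<close> at \<open>x\<close> plus the random signed sum of the coefficients \<open>a\<close>, where \<open>A\<close> is the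
  set of indices with sign \<open>+\<close>. As \<open>I\<close> is an arbitrary finite index set, any coefficients can be split
  off first, and the order of the coefficients never matters.\<close>

definition sign_average :: "'i set \<Rightarrow> ('i \<Rightarrow> real) \<Rightarrow> (real \<Rightarrow> real) \<Rightarrow> real \<Rightarrow> real" where
  "sign_average I a f x = (\<Sum>A\<in>Pow I. f (x + (\<Sum>i\<in>I. if i \<in> A then a i else - a i))) / 2 ^ card I"

lemma sign_average_empty [simp]: "sign_average {} a f x = f x"
  by (simp add: sign_average_def)

lemma sign_average_insert:
  assumes "finite I" "i \<notin> I"
  shows "sign_average (insert i I) a f x = (sign_average I a f (x + a i) + sign_average I a f (x - a i)) / 2"
proof -
  have inj: "inj_on (insert i) (Pow I)" using assms by (auto simp: inj_on_def)
  have disj: "Pow I \<inter> insert i ` Pow I = {}" using assms by auto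
  have sum_with: "(\<Sum>j\<in>insert i I. if j \<in> insert i A then a j else - a j)
      = a i + (\<Sum>j\<in>I. if j \<in> A then a j else - a j)" for A
    using assms by (auto intro!: sum.cong)
  have sum_without: "(\<Sum>j\<in>insert i I. if j \<in> A then a j else - a j)
      = - a i + (\<Sum>j\<in>I. if j \<in> A then a j else - a j)" if "A \<subseteq> I" for A
    using assms that by auto
  have "(\<Sum>A\<in>Pow (insert i I). f (x + (\<Sum>j\<in>insert i I. if j \<in> A then a j else - a j)))
      = (\<Sum>A\<in>Pow I. f (x + (\<Sum>j\<in>insert i I. if j \<in> A then a j else - a j)))
      + (\<Sum>A\<in>Pow I. f (x + (\<Sum>j\<in>insert i I. if j \<in> insert i A then a j else - a j)))"
    unfolding Pow_insert using assms disj by (simp add: sum.union_disjoint sum.reindex[OF inj])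
  also have "\<dots> = (\<Sum>A\<in>Pow I. f (x - a i + (\<Sum>j\<in>I. if j \<in> A then a j else - a j)))
      + (\<Sum>A\<in>Pow I. f (x + a i + (\<Sum>j\<in>I. if j \<in> A then a j else - a j)))"
    unfolding sum_with by (intro arg_cong2[where f = "(+)"] sum.cong refl) (simp_all add: sum_without algebra_simps)
  finally show ?thesis using assms by (simp add: sign_average_def field_simps)
qed

lemma sign_average_cong:
  assumes "\<And>i. i \<in> I \<Longrightarrow> a i = b i"
  shows "sign_average I a f x = sign_average I b f x"
proof -
  have "(\<Sum>i\<in>I. if i \<in> A then a i else - a i) = (\<Sum>i\<in>I. if i \<in> A then b i else - b i)" for A
    by (rule sum.cong) (auto simp: assms)
  then show ?thesis by (simp add: sign_average_def)
qed

lemma sign_average_zero: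
  assumes "finite I" "\<And>i. i \<in> I \<Longrightarrow> a i = 0"
  shows "sign_average I a f x = f x"
  using assms by (induction I) (simp_all add: sign_average_insert)

lemma sign_average_even:
  assumes "finite I" and even: "\<And>x. f (- x) = f x"
  shows "sign_average I a f (- x) = sign_average I a f x"
  using \<open>finite I\<close>
proof (induction I arbitrary: x)
  case (insert i I)
  have "sign_average I a f (- x + a i) = sign_average I a f (x - a i)"
    using insert.IH[of "x - a i"] by simp
  moreover have "sign_average I a f (- x - a i) = sign_average I a f (x + a i)"
    using insert.IH[of "x + a i"] by simp
  ultimately show ?case using insert.hyps by (simp add: sign_average_insert)
qed (simp add: even)

lemma sign_average_abs:
  assumes "finite I"
  shows "sign_average I (\<lambda>i. \<bar>a i\<bar>) f x = sign_average I a f x"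
  using assms
proof (induction I arbitrary: x)
  case (insert i I)
  then show ?case by (cases "a i \<ge> 0") (simp_all add: sign_average_insert)
qed simp

lemma sign_average_scale:
  assumes "finite I"
  shows "sign_average I (\<lambda>i. r * a i) f (r * x) = sign_average I a (\<lambda>s. f (r * s)) x"
  using assms
proof (induction I arbitrary: x)
  case (insert i I)
  have "r * x + r * a i = r * (x + a i)" "r * x - r * a i = r * (x - a i)" by algebra+
  with insert show ?case by (simp add: sign_average_insert)
qed simp

lemma sign_average_cmult: "sign_average I a (\<lambda>s. c * f s) x = c * sign_average I a f x"
  by (simp add: sign_average_def sum_distrib_left)

lemma sign_average_nonneg: "(\<And>s. 0 \<le> f s) \<Longrightarrow> 0 \<le> sign_average I a f x"
  by (simp add: sign_average_def sum_nonneg)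

lemma sign_average_const_card:
  assumes "finite I" "finite J" "card I = card J"
  shows "sign_average I (\<lambda>_. y) f x = sign_average J (\<lambda>_. y) f x"
  using assms
proof (induction I arbitrary: J x)
  case (insert i I)
  then obtain j J' where J: "J = insert j J'" "j \<notin> J'" "card J' = card I"
    by (metis card_Suc_eq card_insert_disjoint)
  with insert.prems have "finite J'" by simp
  with insert J show ?case by (simp add: sign_average_insert)
qed simp

text \<open>At \<open>x = 0\<close> the fourth moment depends only on the second and fourth power sums of the coefficients,
  so that an exchange preserving both leaves it unchanged.\<close>

lemma sign_average_fourth_power:
  assumes "finite I"
  shows "sign_average I a (\<lambda>s. s ^ 4) x =
    x ^ 4 + 6 * x\<^sup>2 * (\<Sum>i\<in>I. (a i)\<^sup>2) + 3 * (\<Sum>i\<in>I. (a i)\<^sup>2)\<^sup>2 - 2 * (\<Sum>i\<in>I. (a i) ^ 4)"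
  using assms
proof (induction I arbitrary: x)
  case (insert i I)
  show ?case
    using insert.hyps unfolding sign_average_insert[OF insert.hyps] insert.IH
    by (simp add: eval_nat_numeral field_simps)
qed simp

lemma has_convex_fourth_derivative_sign_average:
  assumes "finite I" "has_convex_fourth_derivative f"
  shows "has_convex_fourth_derivative (sign_average I a f)"
  using assms
proof (induction I)
  case empty
  then show ?case by simp
next
  case (insert i I)
  have "sign_average (insert i I) a f
      = (\<lambda>x. (sign_average I a f (x + a i) + sign_average I a f (x - a i)) / 2)"
    using insert.hyps by (intro ext sign_average_insert)
  with insert show ?case by (simp add: has_convex_fourth_derivative_average)
qed

lemma sign_average_insert3:
  assumes "finite J" "i \<notin> J" "j \<notin> J" "k \<notin> J" "i \<noteq> j" "i \<noteq> k" "j \<noteq> k"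
    and even: "\<And>x. f (- x) = f x"
  shows "sign_average (insert i (insert j (insert k J))) a f 0 =
    sign_sum3 (sign_average J a f) (a i) (a j) (a k) / 4"
proof -
  let ?g = "sign_average J a f"
  have g: "?g (- x) = ?g x" for x by (rule sign_average_even) fact+
  have "?g (- a i - a j - a k) = ?g (a i + a j + a k)" "?g (- a i - a j + a k) = ?g (a i + a j - a k)"
    "?g (- a i + a j - a k) = ?g (a i - a j + a k)" "?g (a i - a j - a k) = ?g (- a i + a j + a k)"
    using g[of "a i + a j + a k"] g[of "a i + a j - a k"] g[of "a i - a j + a k"] g[of "- a i + a j + a k"]
    by (simp_all add: algebra_simps)
  note reflect = this
  have "sign_average (insert i (insert j (insert k J))) a f 0 =
    (((?g (a i + a j + a k) + ?g (a i + a j - a k)) / 2 + (?g (a i - a j + a k) + ?g (a i - a j - a k)) / 2) / 2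
    + ((?g (- a i + a j + a k) + ?g (- a i + a j - a k)) / 2
      + (?g (- a i - a j + a k) + ?g (- a i - a j - a k)) / 2) / 2) / 2"
    using assms by (simp add: sign_average_insert)
  also have "\<dots> = sign_sum3 ?g (a i) (a j) (a k) / 4"
    unfolding reflect sign_sum3_def by argo
  finally show ?thesis .
qed

section \<open>Rademacher sums\<close>

context rademacher_sequence
begin

lemma expectation_sign_average:
  assumes [measurable]: "f \<in> borel_measurable borel"
  shows "(\<integral>\<omega>. f (x + rademacher_sum \<epsilon> m a \<omega>) \<partial>M) = sign_average {1..m} a f x"
proof -
  define E where "E A = {\<omega> \<in> space M. \<forall>i\<in>{1..m}. \<epsilon> i \<omega> = (if i \<in> A then 1 else - 1)}" for A
  define T where "T A = f (x + (\<Sum>i\<in>{1..m}. if i \<in> A then a i else - a i))" for A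
  have prob_E: "prob (E A) = (1 / 2) ^ m" for A
    unfolding E_def by (rule prob_signs) auto
  then have "prob (E A) \<noteq> 0" for A by simp
  then have [measurable]: "E A \<in> sets M" for A using measure_notin_sets by blast
  have [measurable]: "rademacher_sum \<epsilon> m a \<in> borel_measurable M" by (rule rademacher_sum_measurable)
  have AE_eq: "AE \<omega> in M. f (x + rademacher_sum \<epsilon> m a \<omega>) = (\<Sum>A\<in>Pow {1..m}. indicator (E A) \<omega> * T A)"
    using AE_all_abs_eps[of m] AE_space
  proof eventually_elim
    case (elim \<omega>)
    define A0 where "A0 = {i \<in> {1..m}. \<epsilon> i \<omega> = 1}"
    have eps: "\<epsilon> i \<omega> = (if i \<in> A0 then 1 else - 1)" if "i \<in> {1..m}" for i
      using elim(1) that by (force simp: A0_def abs_if split: if_splits)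
    have "\<omega> \<in> E A \<longleftrightarrow> A = A0" if "A \<in> Pow {1..m}" for A
    proof
      assume "\<omega> \<in> E A"
      then have "\<forall>i\<in>{1..m}. i \<in> A \<longleftrightarrow> \<epsilon> i \<omega> = 1" by (auto simp: E_def)
      with that show "A = A0" by (auto simp: A0_def)
    next
      assume "A = A0"
      with eps elim(2) show "\<omega> \<in> E A" by (auto simp: E_def)
    qed
    then have "(\<Sum>A\<in>Pow {1..m}. indicator (E A) \<omega> * T A) = (\<Sum>A\<in>Pow {1..m}. if A = A0 then T A else 0)"
      by (intro sum.cong) (auto simp: indicator_def)
    also have "\<dots> = T A0" by (subst sum.delta) (auto simp: A0_def)
    also have "\<dots> = f (x + rademacher_sum \<epsilon> m a \<omega>)"
      unfolding T_def rademacher_sum_def by (intro arg_cong[where f = f] arg_cong2[where f = "(+)"] sum.cong) (auto simp: eps)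
    finally show ?case by simp
  qed
  have "(\<integral>\<omega>. f (x + rademacher_sum \<epsilon> m a \<omega>) \<partial>M) = (\<integral>\<omega>. (\<Sum>A\<in>Pow {1..m}. indicator (E A) \<omega> * T A) \<partial>M)"
    by (rule integral_cong_AE[OF _ _ AE_eq]) measurable
  also have "\<dots> = (\<Sum>A\<in>Pow {1..m}. \<integral>\<omega>. indicator (E A) \<omega> * T A \<partial>M)"
    by (intro Bochner_Integration.integral_sum integrable_mult_left integrable_real_indicator)
      (auto simp: less_top[symmetric])
  also have "\<dots> = (\<Sum>A\<in>Pow {1..m}. (1 / 2) ^ m * T A)"
    by (simp add: prob_E)
  also have "\<dots> = sign_average {1..m} a f x"
    by (simp add: sign_average_def T_def sum_divide_distrib power_one_over)
  finally show ?thesis .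
qed

end

definition sign_norm :: "real \<Rightarrow> 'i set \<Rightarrow> ('i \<Rightarrow> real) \<Rightarrow> real \<Rightarrow> real" where
  "sign_norm p I a x = sign_average I a (\<lambda>s. \<bar>s\<bar> powr p) x powr (1 / p)"

lemma sign_norm_nonneg: "0 \<le> sign_norm p I a x"
  by (simp add: sign_norm_def)

lemma sign_norm_scale:
  assumes "finite I" "0 \<le> r" "0 < p"
  shows "sign_norm p I (\<lambda>i. r * a i) (r * x) = r * sign_norm p I a x"
proof -
  have "sign_average I (\<lambda>i. r * a i) (\<lambda>s. \<bar>s\<bar> powr p) (r * x)
      = r powr p * sign_average I a (\<lambda>s. \<bar>s\<bar> powr p) x"
    using assms by (simp add: sign_average_scale sign_average_cmult[symmetric] abs_mult powr_mult)
  then show ?thesis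
    using assms by (simp add: sign_norm_def powr_mult powr_powr sign_average_nonneg)
qed

text \<open>By symmetry the sign of a single coefficient is irrelevant, so it can serve as a deterministic shift.\<close>

lemma sign_norm_insert_zero:
  assumes "finite I" "i \<notin> I"
  shows "sign_norm p (insert i I) a 0 = sign_norm p I a (a i)"
proof -
  have "sign_average I a (\<lambda>s. \<bar>s\<bar> powr p) (- a i) = sign_average I a (\<lambda>s. \<bar>s\<bar> powr p) (a i)"
    using assms by (intro sign_average_even) auto
  then show ?thesis using assms by (simp add: sign_norm_def sign_average_insert)
qed

lemma sign_average_powr_four:
  assumes "finite I"
  shows "sign_average I a (\<lambda>s. \<bar>s\<bar> powr 4) 0 = 3 * (\<Sum>i\<in>I. (a i)\<^sup>2)\<^sup>2 - 2 * (\<Sum>i\<in>I. (a i) ^ 4)"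
proof -
  have "(\<lambda>s::real. \<bar>s\<bar> powr 4) = (\<lambda>s. s ^ 4)"
    by (simp add: fun_eq_iff powr_numeral)
  then show ?thesis using sign_average_fourth_power[OF assms, of a 0] by simp
qed

context rademacher_sequence
begin

lemma Lp_norm_shift: "Lp_norm M p (\<lambda>\<omega>. x + rademacher_sum \<epsilon> m a \<omega>) = sign_norm p {1..m} a x"
  unfolding Lp_norm_def sign_norm_def by (subst expectation_sign_average) auto

lemma Lp_norm_rademacher_sum: "Lp_norm M p (rademacher_sum \<epsilon> m a) = sign_norm p {1..m} a 0"
  using Lp_norm_shift[of p 0 m a] by simp

lemma Lp_norm_mono:
  assumes X: "X \<in> borel_measurable M" and B: "AE \<omega> in M. \<bar>X \<omega>\<bar> \<le> B" and pq: "0 < q" "q \<le> p"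
  shows "Lp_norm M q X \<le> Lp_norm M p X"
proof -
  define Y where "Y \<omega> = \<bar>X \<omega>\<bar> powr q" for \<omega>
  have eq: "\<bar>Y \<omega>\<bar> powr (p / q) = \<bar>X \<omega>\<bar> powr p" for \<omega>
    using pq by (simp add: Y_def powr_powr)
  have "\<bar>expectation Y\<bar> powr (p / q) \<le> expectation (\<lambda>\<omega>. \<bar>Y \<omega>\<bar> powr (p / q))"
  proof (rule jensens_inequality[where I = UNIV])
    show "integrable M Y" unfolding Y_def by (rule integrable_powr[OF X B]) (use pq in simp)
    show "integrable M (\<lambda>\<omega>. \<bar>Y \<omega>\<bar> powr (p / q))"
      unfolding eq by (rule integrable_powr[OF X B]) (use pq in simp)
    show "convex_on UNIV (\<lambda>t. \<bar>t\<bar> powr (p / q))"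
      by (rule convex_on_abs_powr) (use pq in simp)
  qed auto
  then have "expectation Y powr (p / q) \<le> (\<integral>\<omega>. \<bar>X \<omega>\<bar> powr p \<partial>M)"
    unfolding eq by (simp add: Y_def)
  then have "(expectation Y powr (p / q)) powr (1 / p) \<le> (\<integral>\<omega>. \<bar>X \<omega>\<bar> powr p \<partial>M) powr (1 / p)"
    using pq by (intro powr_mono2) auto
  moreover have "expectation Y = (\<integral>\<omega>. \<bar>X \<omega>\<bar> powr q \<partial>M)"
    by (rule Bochner_Integration.integral_cong) (simp_all add: Y_def)
  ultimately show ?thesis using pq by (simp add: Lp_norm_def powr_powr)
qed

end

definition sign_ratio :: "real \<Rightarrow> 'i set \<Rightarrow> ('i \<Rightarrow> real) \<Rightarrow> real \<Rightarrow> real" where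
  "sign_ratio p I a x = sign_norm p I a x / sign_norm 4 I a x"

lemma sign_ratio_scale:
  assumes "finite I" "0 < r" "0 < p"
  shows "sign_ratio p I (\<lambda>i. r * a i) (r * x) = sign_ratio p I a x"
  using assms by (simp add: sign_ratio_def sign_norm_scale)

text \<open>Conditioning on the signs outside \<open>{i, j, k}\<close> reduces the \<open>p\<close>-th moment to \<open>exchange_three\<close>, applied to
  the average of \<open>\<bar>s\<bar> powr p\<close> over those signs; the fourth moment stays the same. The sum of the sixth
  powers is the third power sum of the squares and grows strictly.\<close>

lemma sign_ratio_exchange:
  fixes p :: real
  assumes p: "5 \<le> p" and I: "finite I" and b: "\<And>i. i \<in> I \<Longrightarrow> 0 \<le> b i"
    and ijk: "i \<in> I" "j \<in> I" "k \<in> I" "i \<noteq> j" "i \<noteq> k" "j \<noteq> k"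
    and order: "b j \<le> b i" "b k < b j"
  shows "\<exists>b'. (\<forall>l. l \<notin> I \<longrightarrow> b' l = b l) \<and> (\<Sum>l\<in>I. (b' l)\<^sup>2) = (\<Sum>l\<in>I. (b l)\<^sup>2) \<and>
    (\<Sum>l\<in>I. (b l) ^ 6) < (\<Sum>l\<in>I. (b' l) ^ 6) \<and> sign_ratio p I b 0 \<le> sign_ratio p I b' 0"
proof -
  define J where "J = I - {i, j, k}"
  have J: "finite J" "i \<notin> J" "j \<notin> J" "k \<notin> J" using I by (auto simp: J_def)
  have I_eq: "I = insert i (insert j (insert k J))" using ijk by (auto simp: J_def)
  define f where "f = (\<lambda>s::real. \<bar>s\<bar> powr p)"
  have even: "f (- s) = f s" for s by (simp add: f_def)
  let ?g = "sign_average J b f"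
  have g: "has_convex_fourth_derivative ?g"
    unfolding f_def by (rule has_convex_fourth_derivative_sign_average[OF J(1) has_convex_fourth_derivative_abs_powr[OF p]])
  have g_even: "?g (- s) = ?g s" for s using J(1) even by (rule sign_average_even)
  have nonneg: "0 \<le> b i" "0 \<le> b j" "0 \<le> b k" using b ijk by auto
  have u: "(b j)\<^sup>2 \<le> (b i)\<^sup>2" "(b k)\<^sup>2 < (b j)\<^sup>2" "0 \<le> (b k)\<^sup>2"
    using order nonneg by (auto intro: power_mono power_strict_mono)
  obtain v w where vw: "0 \<le> w" "0 \<le> v" "v + 2 * w = (b i)\<^sup>2 + (b j)\<^sup>2 + (b k)\<^sup>2"
    "v\<^sup>2 + 2 * w\<^sup>2 = ((b i)\<^sup>2)\<^sup>2 + ((b j)\<^sup>2)\<^sup>2 + ((b k)\<^sup>2)\<^sup>2"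
    "v ^ 3 + 2 * w ^ 3 > ((b i)\<^sup>2) ^ 3 + ((b j)\<^sup>2) ^ 3 + ((b k)\<^sup>2) ^ 3"
    "sign_sum3 ?g (sqrt ((b i)\<^sup>2)) (sqrt ((b j)\<^sup>2)) (sqrt ((b k)\<^sup>2)) \<le> sign_sum3 ?g (sqrt v) (sqrt w) (sqrt w)"
    by (rule exchange_three[OF g g_even u])
  define b' where "b' = b(i := sqrt v, j := sqrt w, k := sqrt w)"
  have b': "b' i = sqrt v" "b' j = sqrt w" "b' k = sqrt w" using ijk by (auto simp: b'_def)
  have b'_J: "b' l = b l" if "l \<in> J" for l using that J by (auto simp: b'_def)
  have sums: "(\<Sum>l\<in>I. \<phi> (c l)) = \<phi> (c i) + \<phi> (c j) + \<phi> (c k) + (\<Sum>l\<in>J. \<phi> (c l))" for \<phi> c :: "_ \<Rightarrow> real"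
    unfolding I_eq using J ijk by (simp add: add.assoc)
  have sums': "(\<Sum>l\<in>J. \<phi> (b' l)) = (\<Sum>l\<in>J. \<phi> (b l))" for \<phi> :: "real \<Rightarrow> real"
    by (rule sum.cong) (auto simp: b'_J)
  have root: "sqrt t ^ 4 = t\<^sup>2" "sqrt t ^ 6 = t ^ 3" if "0 \<le> t" for t
  proof -
    have "sqrt t ^ (2 * n) = t ^ n" for n using that by (simp add: power_mult)
    from this[of 2] this[of 3] show "sqrt t ^ 4 = t\<^sup>2" "sqrt t ^ 6 = t ^ 3" by simp_all
  qed
  have s2: "(\<Sum>l\<in>I. (b' l)\<^sup>2) = (\<Sum>l\<in>I. (b l)\<^sup>2)"
    using sums[of "\<lambda>t. t\<^sup>2" b] sums[of "\<lambda>t. t\<^sup>2" b'] sums'[of "\<lambda>t. t\<^sup>2"] vw(1-3) by (simp add: b')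
  have s4: "(\<Sum>l\<in>I. (b' l) ^ 4) = (\<Sum>l\<in>I. (b l) ^ 4)"
    using sums[of "\<lambda>t. t ^ 4" b] sums[of "\<lambda>t. t ^ 4" b'] sums'[of "\<lambda>t. t ^ 4"] vw(1,2,4) by (simp add: b' root)
  have s6: "(\<Sum>l\<in>I. (b l) ^ 6) < (\<Sum>l\<in>I. (b' l) ^ 6)"
    using sums[of "\<lambda>t. t ^ 6" b] sums[of "\<lambda>t. t ^ 6" b'] sums'[of "\<lambda>t. t ^ 6"] vw(1,2,5) by (simp add: b' root)
  have "sign_average J b' f = ?g" by (intro ext sign_average_cong b'_J)
  then have "sign_average I b f 0 \<le> sign_average I b' f 0"
    unfolding I_eq using vw(6) nonneg by (simp add: sign_average_insert3 J ijk even b')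
  then have "sign_norm p I b 0 \<le> sign_norm p I b' 0"
    unfolding sign_norm_def f_def using p by (intro powr_mono2) (auto intro: sign_average_nonneg)
  moreover have "sign_norm 4 I b 0 = sign_norm 4 I b' 0"
    unfolding sign_norm_def sign_average_powr_four[OF I] s2 s4 ..
  ultimately have "sign_ratio p I b 0 \<le> sign_ratio p I b' 0"
    unfolding sign_ratio_def by (simp add: divide_right_mono sign_norm_nonneg)
  moreover have "\<forall>l. l \<notin> I \<longrightarrow> b' l = b l" using ijk by (auto simp: b'_def)
  ultimately show ?thesis using s2 s6 by blast
qed

lemma sign_ratio_abs: "finite I \<Longrightarrow> sign_ratio p I (\<lambda>i. \<bar>a i\<bar>) x = sign_ratio p I a x"
  by (simp add: sign_ratio_def sign_norm_def sign_average_abs)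

context rademacher_sequence
begin

text \<open>Vectors with a single nonzero entry have ratio \<open>1\<close>, the limit of the shifted family as
  \<open>x \<rightarrow> \<infinity>\<close>. By Jensen's inequality no vector has a
  smaller ratio, so such vectors do not exceed the supremum over the shifts.\<close>

lemma one_le_sign_ratio:
  assumes a: "a \<in> unit_sphere m" and p: "4 \<le> p"
  shows "1 \<le> sign_ratio p {1..m} a 0"
proof -
  have "Lp_norm M 4 (rademacher_sum \<epsilon> m a) \<le> Lp_norm M p (rademacher_sum \<epsilon> m a)"
    by (rule Lp_norm_mono[OF rademacher_sum_measurable AE_rademacher_sum_le[OF a]]) (use p in auto)
  moreover have "0 < Lp_norm M 4 (rademacher_sum \<epsilon> m a)" by (rule Lp_norm_rademacher_sum_pos[OF a]) simp
  ultimately show ?thesis by (simp add: sign_ratio_def Lp_norm_rademacher_sum)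
qed

text \<open>Among all maximizers of the ratio, which form a compact set, one with the largest sum of sixth powers
  admits no exchange. Hence of any three of its entries (in absolute value) the two smallest agree, and
  all entries other than a largest one are equal.\<close>

lemma concentrated_maximizer:
  assumes p: "5 \<le> p" and m: "1 \<le> m"
  obtains b i y where "b \<in> unit_sphere m" "sign_ratio p {1..m} b 0 = khintchine_const M \<epsilon> p 4 m"
    "i \<in> {1..m}" "0 \<le> y" "y \<le> b i" "\<And>j. j \<in> {1..m} \<Longrightarrow> j \<noteq> i \<Longrightarrow> b j = y"
proof -
  let ?I = "{1..m}"
  define C where "C = khintchine_const M \<epsilon> p 4 m"
  define r where "r a = Lp_norm M p (rademacher_sum \<epsilon> m a) / Lp_norm M 4 (rademacher_sum \<epsilon> m a)" for a
  have r: "r a = sign_ratio p ?I a 0" for a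
    by (simp add: r_def sign_ratio_def Lp_norm_rademacher_sum)
  obtain a0 where a0: "a0 \<in> unit_sphere m" "r a0 = C" and max: "\<And>b. b \<in> unit_sphere m \<Longrightarrow> r b \<le> C"
  proof -
    have "\<exists>a\<in>unit_sphere m. C = r a \<and> (\<forall>b\<in>unit_sphere m. r b \<le> C)"
      unfolding C_def r_def by (rule khintchine_const_is_max[OF m]) (use p in auto)
    then show thesis using that by blast
  qed
  define K where "K = unit_sphere m \<inter> r -` {C}"
  have "continuous_on (unit_sphere m) r"
    unfolding r_def using p
    by (intro continuous_on_divide continuous_on_Lp_norm) (auto simp: less_imp_neq[OF Lp_norm_rademacher_sum_pos, symmetric])
  then have "closed K"
    unfolding K_def by (rule continuous_closed_preimage) (auto intro: compact_imp_closed compact_unit_sphere)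
  then have "compact K"
    using compact_Int_closed[OF compact_unit_sphere[of m], of K] by (simp add: K_def)
  moreover have "K \<noteq> {}" using a0 by (auto simp: K_def)
  moreover have "continuous_on K (\<lambda>a. \<Sum>i\<in>?I. (a i) ^ 6)"
    by (intro continuous_intros continuous_on_coordinate)
  ultimately obtain a where a: "a \<in> K" and a_max: "\<And>b. b \<in> K \<Longrightarrow> (\<Sum>i\<in>?I. (b i) ^ 6) \<le> (\<Sum>i\<in>?I. (a i) ^ 6)"
    using continuous_attains_sup[of K "\<lambda>a. \<Sum>i\<in>?I. (a i) ^ 6"] by blast
  define b where "b i = \<bar>a i\<bar>" for i
  have b_sphere: "b \<in> unit_sphere m" using a by (auto simp: K_def unit_sphere_def b_def)
  have b_ratio: "sign_ratio p ?I b 0 = C"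
    using a unfolding b_def by (simp add: sign_ratio_abs K_def r)
  have b6: "(\<Sum>i\<in>?I. (b i) ^ 6) = (\<Sum>i\<in>?I. (a i) ^ 6)" by (simp add: b_def)
  have pair: "b j \<le> b k" if ijk: "i \<in> ?I" "j \<in> ?I" "k \<in> ?I" "i \<noteq> j" "i \<noteq> k" "j \<noteq> k" "b j \<le> b i" for i j k
  proof (rule ccontr)
    assume "\<not> b j \<le> b k"
    then have lt: "b k < b j" by simp
    have bnn: "0 \<le> b l" for l by (simp add: b_def)
    obtain b' where b': "\<forall>l. l \<notin> ?I \<longrightarrow> b' l = b l" "(\<Sum>l\<in>?I. (b' l)\<^sup>2) = (\<Sum>l\<in>?I. (b l)\<^sup>2)"
      "(\<Sum>l\<in>?I. (b l) ^ 6) < (\<Sum>l\<in>?I. (b' l) ^ 6)" "sign_ratio p ?I b 0 \<le> sign_ratio p ?I b' 0"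
      using sign_ratio_exchange[OF p finite_atLeastAtMost bnn ijk lt] by metis
    have "b' \<in> unit_sphere m" using b_sphere b'(1,2) by (simp add: unit_sphere_def)
    moreover from this have "r b' = C" using max[of b'] b'(4) b_ratio by (simp add: r)
    ultimately have "b' \<in> K" by (simp add: K_def)
    from a_max[OF this] b'(3) b6 show False by simp
  qed
  have "finite (b ` ?I)" "b ` ?I \<noteq> {}" using m by auto
  then have "Max (b ` ?I) \<in> b ` ?I" by (rule Max_in)
  then obtain i where i: "i \<in> ?I" "b i = Max (b ` ?I)" by auto
  then have i_max: "b j \<le> b i" if "j \<in> ?I" for j using that by simp
  have eq: "b j = b k" if "j \<in> ?I" "k \<in> ?I" "j \<noteq> i" "k \<noteq> i" for j k
  proof (cases "j = k")
    case False
    show ?thesis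
      by (rule antisym; rule pair[of i]) (use that i i_max False in simp_all)
  qed simp
  show thesis
  proof (cases "?I - {i} = {}")
    case True
    then have "\<And>j. j \<in> ?I \<Longrightarrow> j \<noteq> i \<Longrightarrow> b j = 0" by blast
    then show thesis by (intro that[of b i 0]) (use b_sphere b_ratio i(1) in \<open>auto simp: C_def b_def\<close>)
  next
    case False
    then obtain j where j: "j \<in> ?I" "j \<noteq> i" by blast
    have "b k = b j" if "k \<in> ?I" "k \<noteq> i" for k by (rule eq) (use that j in auto)
    moreover have "0 \<le> b j" by (simp add: b_def)
    ultimately show thesis using that[of b i "b j"] b_sphere b_ratio i(1) i_max[OF j(1)] by (simp add: C_def)
  qed
qed

end

theorem proposition2:
  fixes M :: "'a measure" and \<epsilon> :: "nat \<Rightarrow> 'a \<Rightarrow> real" and p :: real and n :: nat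
  assumes "rademacher_sequence M \<epsilon>"
    and "p \<ge> 5" and "n \<ge> 1"
  shows "khintchine_const M \<epsilon> p 4 (n + 1) =
    (SUP x\<in>{1..}. Lp_norm M p (\<lambda>\<omega>. x + (\<Sum>i=1..n. \<epsilon> i \<omega>)) /
                  Lp_norm M 4 (\<lambda>\<omega>. x + (\<Sum>i=1..n. \<epsilon> i \<omega>)))"
proof -
  interpret rademacher_sequence M \<epsilon> by fact
  note p = \<open>p \<ge> 5\<close>
  let ?I = "{1..n + 1}"
  define R where "R x = sign_ratio p {1..n} (\<lambda>_. 1) x" for x
  have norm: "Lp_norm M q (\<lambda>\<omega>. x + (\<Sum>i=1..n. \<epsilon> i \<omega>)) = sign_norm q {1..n} (\<lambda>_. 1) x" for q x
    using Lp_norm_shift[of q x n "\<lambda>_. 1"] by (simp add: rademacher_sum_def)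
  have bdd: "bdd_above (R ` {1..})"
    using bdd_above_shift_ratio[of p 4 n, unfolded norm] p by (simp add: R_def sign_ratio_def)
  have ratio_eq: "Lp_norm M p (rademacher_sum \<epsilon> m a) / Lp_norm M 4 (rademacher_sum \<epsilon> m a)
      = sign_ratio p {1..m} a 0" for m a
    by (simp add: sign_ratio_def Lp_norm_rademacher_sum)
  have one_spike: "sign_ratio p ?I b 0 = R (b i / y)"
    if "i \<in> ?I" "0 < y" "\<And>j. j \<in> ?I \<Longrightarrow> j \<noteq> i \<Longrightarrow> b j = y" for b i y
  proof -
    have I: "?I = insert i (?I - {i})" using that by auto
    have "card (?I - {i}) = card {1..n}" using that by simp
    then have "sign_average (?I - {i}) b f (b i) = sign_average {1..n} (\<lambda>_. y) f (b i)" for f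
      using that by (subst sign_average_cong[where b = "\<lambda>_. y"]) (auto intro!: sign_average_const_card)
    then have "sign_norm q ?I b 0 = sign_norm q {1..n} (\<lambda>_. y) (b i)" for q
      by (subst I, subst sign_norm_insert_zero) (simp_all add: sign_norm_def)
    then have "sign_ratio p ?I b 0 = sign_ratio p {1..n} (\<lambda>_. y * 1) (y * (b i / y))"
      using that by (simp add: sign_ratio_def)
    also have "\<dots> = R (b i / y)"
      unfolding R_def by (rule sign_ratio_scale) (use that p in auto)
    finally show ?thesis .
  qed
  have shift_on_sphere: "\<exists>b\<in>unit_sphere (n + 1). sign_ratio p ?I b 0 = R x" for x
  proof -
    define y where "y = 1 / sqrt (x\<^sup>2 + n)"
    have pos: "0 < x\<^sup>2 + n" using \<open>n \<ge> 1\<close> by (simp add: add_nonneg_pos)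
    then have y: "0 < y" "y\<^sup>2 = 1 / (x\<^sup>2 + n)" by (auto simp: y_def power_divide)
    define b where "b i = (if i = n + 1 then x * y else if i \<in> {1..n} then y else 0)" for i
    have "(\<Sum>i\<in>{1..n}. (b i)\<^sup>2) = (\<Sum>i\<in>{1..n}. y\<^sup>2)"
      by (rule sum.cong) (auto simp: b_def)
    then have "(\<Sum>i\<in>?I. (b i)\<^sup>2) = (x\<^sup>2 + n) * y\<^sup>2"
      by (simp add: b_def power_mult_distrib algebra_simps)
    also have "\<dots> = 1" using pos by (simp add: y(2))
    finally have "b \<in> unit_sphere (n + 1)" by (auto simp: unit_sphere_def b_def)
    moreover have "sign_ratio p ?I b 0 = R (b (n + 1) / y)"
      by (rule one_spike) (use y in \<open>auto simp: b_def\<close>)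
    then have "sign_ratio p ?I b 0 = R x" using y by (simp add: b_def)
    ultimately show ?thesis by blast
  qed
  have R_le: "R x \<le> khintchine_const M \<epsilon> p 4 (n + 1)" for x
    using shift_on_sphere[of x] khintchine_const_is_max[of "n + 1" p 4] p by (auto simp: ratio_eq)
  have one_le: "1 \<le> R 1"
  proof -
    obtain b where "b \<in> unit_sphere (n + 1)" "sign_ratio p ?I b 0 = R 1"
      using shift_on_sphere by blast
    then show ?thesis using one_le_sign_ratio[of b "n + 1" p] p by simp
  qed
  have "khintchine_const M \<epsilon> p 4 (n + 1) = (SUP x\<in>{1..}. R x)"
  proof (rule antisym)
    show "(SUP x\<in>{1..}. R x) \<le> khintchine_const M \<epsilon> p 4 (n + 1)"
      by (rule cSUP_least) (use R_le in simp_all)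
    obtain b i y where b: "b \<in> unit_sphere (n + 1)" "sign_ratio p ?I b 0 = khintchine_const M \<epsilon> p 4 (n + 1)"
      "i \<in> ?I" "0 \<le> y" "y \<le> b i" "\<And>j. j \<in> ?I \<Longrightarrow> j \<noteq> i \<Longrightarrow> b j = y"
      using concentrated_maximizer[OF p, of "n + 1"] by auto
    show "khintchine_const M \<epsilon> p 4 (n + 1) \<le> (SUP x\<in>{1..}. R x)"
    proof (cases "y = 0")
      case False
      with b have "khintchine_const M \<epsilon> p 4 (n + 1) = R (b i / y)" "1 \<le> b i / y"
        using one_spike[of i y b] by auto
      then show ?thesis using cSUP_upper[OF _ bdd, of "b i / y"] by simp
    next
      case True
      have I: "?I = insert i (?I - {i})" using b(3) by auto
      have "sign_average (?I - {i}) b f (b i) = f (b i)" for f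
        by (rule sign_average_zero) (use b(6) True in auto)
      then have "sign_norm q ?I b 0 = \<bar>b i\<bar>" if "0 < q" for q
        using that by (subst I, subst sign_norm_insert_zero) (simp_all add: sign_norm_def powr_powr)
      then have "khintchine_const M \<epsilon> p 4 (n + 1) \<le> 1" using b(2)[symmetric] p by (simp add: sign_ratio_def)
      also have "\<dots> \<le> (SUP x\<in>{1..}. R x)" using one_le cSUP_upper[OF _ bdd, of 1] by simp
      finally show ?thesis .
    qed
  qed
  then show ?thesis unfolding norm R_def sign_ratio_def .
qed

end
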